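(* There exist a family of sets $\vec X=\langle X_n:n\in\omega\rangle$ and a collection $Y$ of infinite subsets of $\omega$ such that: (i) for no $P\in Y$ is there an $(\vec X\oplus P)$-computable infinite $\vec X$-cohesive set; and (ii) every stable coloring of pairs $[\omega]^2\to 2$ computable from $\vec X$ either has an $(\vec X\oplus P)$-computable infinite homogeneous set for some $P\in Y$, or else, for each $j<2$, has an infinite homogeneous set $H_j$ with color $j$ that computes no infinite $\vec X$-cohesive set.
   Context: A family $\vec X$ is identified with the set $\{\langle n,x\rangle: x\in X_n\}$. A set $Z$ is $\vec X$-cohesive if for each $n$, either $Z\cap X_n$ or $Z\cap\overline{X_n}$ is finite. A coloring $c:[\omega]^2\to2$ is stable if $\lim_y c(x,y)$ exists for each $x$; $H$ is homogeneous with color $j$ for $c$ if $c(x,y)=j$ for all $x<y$ in $H$. *)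

theory Defs
  imports Complex_Main "HOL-Library.Nat_Bijection" "HOL-Library.Ramsey"
begin

text \<open>Oracle computability is introduced through programs for the partial recursive functions
  relative to an oracle, acting on argument lists. \<open>Prim_Rec\<close> and \<open>Mu\<close> use the head of the
  argument list as recursion and search variable, respectively.\<close>

datatype prog =
    Zero
  | Succ
  | Proj nat
  | Oracle
  | Comp prog "prog list"
  | Prim_Rec prog prog
  | Mu prog

text \<open>\<open>computes A p xs y\<close>: on arguments \<open>xs\<close> the program \<open>p\<close> with oracle \<open>A\<close> halts with
  value \<open>y\<close>. In \<open>mu\<close> all values of \<open>p\<close> below the least zero are required to be defined.\<close>

inductive computes :: "nat set \<Rightarrow> prog \<Rightarrow> nat list \<Rightarrow> nat \<Rightarrow> bool" for A :: "nat set" where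
  zero: "computes A Zero xs 0"
| succ: "computes A Succ [x] (Suc x)"
| proj: "i < length xs \<Longrightarrow> computes A (Proj i) xs (xs ! i)"
| oracle_query: "computes A Oracle [x] (of_bool (x \<in> A))"
| comp: "list_all2 (\<lambda>q z. computes A q xs z) qs zs \<Longrightarrow> computes A p zs y
    \<Longrightarrow> computes A (Comp p qs) xs y"
| rec_0: "computes A p xs y \<Longrightarrow> computes A (Prim_Rec p q) (0 # xs) y"
| rec_Suc: "computes A (Prim_Rec p q) (n # xs) z \<Longrightarrow> computes A q (n # z # xs) y
    \<Longrightarrow> computes A (Prim_Rec p q) (Suc n # xs) y"
| mu: "computes A p (n # xs) 0 \<Longrightarrow> (\<forall>m<n. \<exists>k. computes A p (m # xs) (Suc k))
    \<Longrightarrow> computes A (Mu p) xs n"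

lemma computes_deterministic: "computes A p xs y \<Longrightarrow> computes A p xs y' \<Longrightarrow> y = y'"
proof (induction arbitrary: y' rule: computes.induct)
  case (comp xs qs zs p y)
  from comp.prems obtain zs' where zs': "list_all2 (\<lambda>q z. computes A q xs z) qs zs'"
    and p: "computes A p zs' y'"
    by cases blast
  have "zs = zs'"
    using comp.IH(1) zs' by (auto simp: list_all2_conv_all_nth intro!: nth_equalityI)
  then show ?case using comp.IH p by blast
next
  case (rec_0 p xs y q)
  from rec_0.prems show ?case by cases (use rec_0.IH in blast)
next
  case (rec_Suc p q n xs z y)
  from rec_Suc.prems show ?case by cases (use rec_Suc.IH in blast)
next
  case (mu p n xs)
  from mu.prems have other: "computes A p (y' # xs) 0" "\<forall>m<y'. \<exists>k. computes A p (m # xs) (Suc k)"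
    by (cases, blast)+
  have "\<not> n < y'" using other(2) mu.IH(1) by fastforce
  moreover have "\<not> y' < n" using other(1) mu.IH(2) by blast
  ultimately show ?case by simp
qed (erule computes.cases; simp)+

definition computable_from :: "nat set \<Rightarrow> nat set \<Rightarrow> bool" where
  "computable_from A B \<longleftrightarrow> (\<exists>p. \<forall>x. computes A p [x] (of_bool (x \<in> B)))"

text \<open>A coloring of \<open>[\<omega>]\<^sup>2\<close> is a function on two-element sets, and \<open>c(x,y)\<close> with \<open>x < y\<close> is
  \<open>c {x, y}\<close>; programs receive such a pair as the increasing list \<open>[x, y]\<close>.\<close>

definition coloring_computable_from :: "nat set \<Rightarrow> (nat set \<Rightarrow> nat) \<Rightarrow> bool" where
  "coloring_computable_from A c \<longleftrightarrow> (\<exists>p. \<forall>x y. x < y \<longrightarrow> computes A p [x, y] (c {x, y}))"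

definition stable_coloring :: "(nat set \<Rightarrow> nat) \<Rightarrow> bool" where
  "stable_coloring c \<longleftrightarrow> c \<in> nsets UNIV 2 \<rightarrow> {..<2} \<and> (\<forall>x. convergent (\<lambda>y. c {x, y}))"

definition homogeneous :: "(nat set \<Rightarrow> nat) \<Rightarrow> nat \<Rightarrow> nat set \<Rightarrow> bool" where
  "homogeneous c j H \<longleftrightarrow> (\<forall>x\<in>H. \<forall>y\<in>H. x < y \<longrightarrow> c {x, y} = j)"

definition family_set :: "(nat \<Rightarrow> nat set) \<Rightarrow> nat set" where
  "family_set X = {prod_encode (n, x) | n x. x \<in> X n}"

definition cohesive :: "(nat \<Rightarrow> nat set) \<Rightarrow> nat set \<Rightarrow> bool" where
  "cohesive X Z \<longleftrightarrow> (\<forall>n. finite (Z \<inter> X n) \<or> finite (Z \<inter> - X n))"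

definition join :: "nat set \<Rightarrow> nat set \<Rightarrow> nat set" where
  "join A B = {2 * x | x. x \<in> A} \<union> {2 * x + 1 | x. x \<in> B}"

end

theory Submission
  imports Defs "HOL-Library.Countable_Set"
begin

text \<open>Fix a countable collection of reservoirs closed under countably many operations, and build
  the family generically by finite conditions that may in addition lock whole columns. Locking
  ensures that no set enumerated continuously from the family (for a fixed countable list of
  functionals) is infinite and cohesive, while column \<open>0\<close> is kept generic and splits every
  reservoir. The collection \<open>Y\<close> consists of all infinite sets that do not help the family to
  compute a cohesive set. Hence, if a computable stable coloring has no solution from \<open>Y\<close>, the
  greedy homogeneous sets on reservoirs, and on their parts selected by column \<open>0\<close>, must all
  fail, so the set \<open>A\<^sub>j\<close> of points with limit color \<open>j\<close> meets each such set infinitely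
  often, for both \<open>j\<close>.

  A homogeneous set of color \<open>j\<close> is then built by Mathias forcing with these reservoirs, making
  every infinite set that it computes split by column \<open>0\<close>. Given a program, call \<open>n\<close> a label of a
  finite set \<open>F\<close> if the program with oracle \<open>E \<union> F\<close> accepts \<open>n\<close>. Either some reservoir has
  bounded labels, or some \<open>F \<subseteq> A\<^sub>j\<close> has a large label on the desired side of column \<open>0\<close>.\<close>

subsection \<open>Finite information\<close>

text \<open>\<open>P\<close> holds on a neighbourhood of \<open>S\<close> in Cantor space. The type
  is polymorphic because oracles are sets of numbers while generic families are sets of
  pairs.\<close>

definition near :: "'a set \<Rightarrow> ('a set \<Rightarrow> bool) \<Rightarrow> bool" where
  "near S P \<longleftrightarrow> (\<exists>u. finite u \<and> (\<forall>S'. S' \<inter> u = S \<inter> u \<longrightarrow> P S'))"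

lemma near_mem: "near S (\<lambda>S'. x \<in> S' \<longleftrightarrow> x \<in> S)"
  unfolding near_def by (rule exI[of _ "{x}"]) auto

lemma near_all: "(\<And>S'. P S') \<Longrightarrow> near S P"
  unfolding near_def by (rule exI[of _ "{}"]) simp

lemma near_mono: "near S P \<Longrightarrow> (\<And>S'. P S' \<Longrightarrow> Q S') \<Longrightarrow> near S Q"
  unfolding near_def by metis

lemma near_conj:
  assumes "near S P" "near S Q"
  shows "near S (\<lambda>S'. P S' \<and> Q S')"
proof -
  obtain u v where "finite u" "finite v" and u: "\<And>S'. S' \<inter> u = S \<inter> u \<Longrightarrow> P S'"
    and v: "\<And>S'. S' \<inter> v = S \<inter> v \<Longrightarrow> Q S'"
    using assms unfolding near_def by blast
  moreover have "P S' \<and> Q S'" if "S' \<inter> (u \<union> v) = S \<inter> (u \<union> v)" for S'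
    using that u[of S'] v[of S'] by blast
  ultimately show ?thesis
    unfolding near_def by (intro exI[of _ "u \<union> v"]) auto
qed

lemma near_ball:
  assumes "finite A" "\<And>x. x \<in> A \<Longrightarrow> near S (P x)"
  shows "near S (\<lambda>S'. \<forall>x\<in>A. P x S')"
  using assms
proof (induction A)
  case empty
  show ?case by (simp add: near_all)
next
  case (insert x A)
  then have "near S (\<lambda>S'. P x S' \<and> (\<forall>x\<in>A. P x S'))"
    by (intro near_conj) auto
  then show ?case by simp
qed

lemma near_compose:
  assumes "near (f S) P" and "\<And>z. near S (\<lambda>S'. z \<in> f S' \<longleftrightarrow> z \<in> f S)"
  shows "near S (\<lambda>S'. P (f S'))"
proof -
  obtain u where u: "finite u" "\<And>B. B \<inter> u = f S \<inter> u \<Longrightarrow> P B"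
    using assms(1) unfolding near_def by blast
  have "near S (\<lambda>S'. \<forall>z\<in>u. z \<in> f S' \<longleftrightarrow> z \<in> f S)"
    by (rule near_ball) (use u(1) assms(2) in auto)
  then show ?thesis
    by (rule near_mono) (rule u(2), blast)
qed

text \<open>Use principle: a halting computation is a finite derivation and so consults the oracle
  finitely often.\<close>

lemma computes_near: "computes A p xs y \<Longrightarrow> near A (\<lambda>B. computes B p xs y)"
proof (induction rule: computes.induct)
  case (zero xs)
  show ?case by (intro near_all computes.zero)
next
  case (succ x)
  show ?case by (intro near_all computes.succ)
next
  case (proj i xs)
  then show ?case by (intro near_all computes.proj)
next
  case (oracle_query x)
  show ?case
    using near_mem[of A x] proof (rule near_mono)
    fix B assume "x \<in> B \<longleftrightarrow> x \<in> A"
    then show "computes B Oracle [x] (of_bool (x \<in> A))"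
      using computes.oracle_query[of B x] by simp
  qed
next
  case (comp xs qs zs p y)
  have "near A (\<lambda>B. \<forall>i\<in>{..<length qs}. computes B (qs ! i) xs (zs ! i))"
    by (rule near_ball) (use comp.IH(1) in \<open>auto simp: list_all2_conv_all_nth\<close>)
  then have "near A (\<lambda>B. (\<forall>i\<in>{..<length qs}. computes B (qs ! i) xs (zs ! i)) \<and> computes B p zs y)"
    by (rule near_conj) (rule comp.IH(2))
  moreover have "length qs = length zs"
    using comp.IH(1) by (rule list_all2_lengthD)
  ultimately show ?case
    by (elim near_mono) (intro computes.comp, auto simp: list_all2_conv_all_nth)
next
  case (rec_0 p xs y q)
  from rec_0.IH show ?case by (rule near_mono) (rule computes.rec_0)
next
  case (rec_Suc p q n xs z y)
  from near_conj[OF rec_Suc.IH(1,2)] show ?case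
    by (rule near_mono) (blast intro: computes.rec_Suc)
next
  case (mu p n xs)
  from mu.IH(2) obtain k where k: "\<And>m. m < n \<Longrightarrow> near A (\<lambda>B. computes B p (m # xs) (Suc (k m)))"
    by metis
  have "near A (\<lambda>B. \<forall>m\<in>{..<n}. computes B p (m # xs) (Suc (k m)))"
    by (rule near_ball) (use k in auto)
  from near_conj[OF mu.IH(1) this] show ?case
    by (rule near_mono) (blast intro: computes.mu)
qed

lemma mem_iff_computes:
  assumes "\<And>x. computes A p [x] (of_bool (x \<in> Z))"
  shows "x \<in> Z \<longleftrightarrow> computes A p [x] 1"
proof
  show "computes A p [x] 1" if "x \<in> Z" using assms[of x] that by simp
  show "x \<in> Z" if "computes A p [x] 1"
    using computes_deterministic[OF assms that] by (auto simp: of_bool_def split: if_splits)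
qed

instance prog :: countable
  by countable_datatype

text \<open>An infinite greedy set will itself be both the homogeneous solution and the member of
  \<open>Y\<close>; this supplies the required computability.\<close>

lemma computable_from_join_right: "computable_from (join A B) B"
proof -
  let ?J = "join A B"
  define double where "double = Prim_Rec Zero (Comp Succ [Comp Succ [Proj 1]])"
  have double: "computes ?J double [x] (2 * x)" for x
  proof (induction x)
    case 0
    show ?case unfolding double_def using computes.rec_0[OF computes.zero] by simp
  next
    case (Suc x)
    have "computes ?J (Proj 1) [x, 2 * x] (2 * x)"
      using computes.proj[of 1 "[x, 2 * x]" ?J] by simp
    then have "computes ?J (Comp Succ [Proj 1]) [x, 2 * x] (Suc (2 * x))"
      by (intro computes.comp[where zs = "[2 * x]"] computes.succ) simp
    then have "computes ?J (Comp Succ [Comp Succ [Proj 1]]) [x, 2 * x] (Suc (Suc (2 * x)))"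
      by (intro computes.comp[where zs = "[Suc (2 * x)]"] computes.succ) simp
    with Suc show ?case
      unfolding double_def by (auto intro: computes.rec_Suc)
  qed
  have "computes ?J (Comp Oracle [Comp Succ [double]]) [x] (of_bool (x \<in> B))" for x
  proof -
    have "of_bool (x \<in> B) = (of_bool (Suc (2 * x) \<in> ?J) :: nat)"
      unfolding join_def by (auto simp: of_bool_def) presburger+
    moreover have "computes ?J Oracle [Suc (2 * x)] (of_bool (Suc (2 * x) \<in> ?J))"
      by (rule computes.oracle_query)
    moreover have "computes ?J (Comp Succ [double]) [x] (Suc (2 * x))"
      by (rule computes.comp[where zs = "[2 * x]"]) (auto intro: double computes.succ)
    ultimately show ?thesis
      by (auto intro: computes.comp[where zs = "[Suc (2 * x)]"])
  qed
  then show ?thesis unfolding computable_from_def by blast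
qed

subsection \<open>Generic families\<close>

text \<open>Serves three forcings: conditions for the family, infinite sets under inclusion, and
  Mathias conditions. In \<open>r c' c\<close> the first argument is the stronger condition.\<close>

lemma rasiowa_sikorski:
  fixes r :: "'c \<Rightarrow> 'c \<Rightarrow> bool"
  assumes count: "countable \<D>" and init: "C c0"
    and refl: "\<And>c. r c c" and trans: "\<And>a b c. r a b \<Longrightarrow> r b c \<Longrightarrow> r a c"
    and dense: "\<And>d c. d \<in> \<D> \<Longrightarrow> C c \<Longrightarrow> \<exists>c'. C c' \<and> r c' c \<and> c' \<in> d"
  obtains f :: "nat \<Rightarrow> 'c" where "f 0 = c0" "\<And>n. C (f n)" "\<And>m n. m \<le> n \<Longrightarrow> r (f n) (f m)"
    "\<And>d. d \<in> \<D> \<Longrightarrow> \<exists>n. f n \<in> d"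
proof -
  let ?d = "from_nat_into (insert UNIV \<D>)"
  have step: "\<exists>c'. C c' \<and> r c' c \<and> c' \<in> ?d n" if "C c" for c n
    using from_nat_into[of "insert UNIV \<D>" n] dense[of "?d n" c] that refl[of c]
    by auto
  have "\<exists>f. f 0 = c0 \<and> (\<forall>n. C (f n) \<and> r (f (Suc n)) (f n) \<and> f (Suc n) \<in> ?d n)"
  proof -
    have "\<exists>f. \<forall>n. (C (f n) \<and> (n = 0 \<longrightarrow> f n = c0)) \<and> (r (f (Suc n)) (f n) \<and> f (Suc n) \<in> ?d n)"
    proof (rule dependent_nat_choice)
      show "\<exists>x. C x \<and> (0 = (0::nat) \<longrightarrow> x = c0)" using init by blast
    qed (use step in \<open>metis nat.simps(3)\<close>)
    then show ?thesis by blast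
  qed
  then obtain f where f: "f 0 = c0" "\<And>n. C (f n)" "\<And>n. r (f (Suc n)) (f n)" "\<And>n. f (Suc n) \<in> ?d n"
    by blast
  have mono: "r (f n) (f m)" if "m \<le> n" for m n
    using that
  proof (induction rule: dec_induct)
    case base
    show ?case by (rule refl)
  next
    case (step k)
    show ?case by (rule trans[OF f(3) step.IH])
  qed
  have meet: "\<exists>n. f n \<in> d" if "d \<in> \<D>" for d
  proof -
    have "d \<in> insert UNIV \<D>" "countable (insert UNIV \<D>)" using that count by auto
    then obtain n where "?d n = d" using from_nat_into_surj by metis
    with f(4) show ?thesis by metis
  qed
  show thesis by (rule that[of f, OF f(1,2) mono meet])
qed

type_synonym condition = "(nat \<times> nat) set \<times> (nat \<times> nat) set \<times> nat set"

text \<open>A condition \<open>(D, V, K)\<close> fixes the generic set to be \<open>V\<close> on \<open>D\<close>. Columns may be decided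
  completely, except for those in \<open>K\<close>, which must stay undecided up to finitely many positions.\<close>

fun cond :: "condition \<Rightarrow> bool" where
  "cond (D, V, K) \<longleftrightarrow> finite K \<and> 0 \<in> K \<and> finite (fst ` D) \<and> (\<forall>k\<in>K. finite {n. (k, n) \<in> D})"

fun extends :: "condition \<Rightarrow> condition \<Rightarrow> bool" where
  "extends (D', V', K') (D, V, K) \<longleftrightarrow> D \<subseteq> D' \<and> V' \<inter> D = V \<inter> D \<and> K \<subseteq> K'"

fun forces :: "((nat \<times> nat) set \<Rightarrow> nat set) \<Rightarrow> nat \<Rightarrow> bool \<Rightarrow> nat \<Rightarrow> condition \<Rightarrow> bool" where
  "forces W k i N (D, V, K) \<longleftrightarrow>
    (\<exists>n>N. (k, n) \<in> D \<and> ((k, n) \<in> V \<longleftrightarrow> i) \<and> (\<forall>S. S \<inter> D = V \<inter> D \<longrightarrow> n \<in> W S))"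

text \<open>\<open>near\<close> keeps only the elements put into \<open>W S\<close> by a finite part
  of \<open>S\<close>, since \<open>W\<close> is an arbitrary function and may be discontinuous away
  from the generic set.\<close>

definition forces_finite :: "((nat \<times> nat) set \<Rightarrow> nat set) \<Rightarrow> condition set" where
  "forces_finite W = {(D, V, K). \<exists>b. \<forall>S. S \<inter> D = V \<inter> D \<longrightarrow> {n. near S (\<lambda>S'. n \<in> W S')} \<subseteq> {..b}}"

text \<open>Density below \<open>q\<close> suffices: a generic sequence through \<open>q\<close>
  then meets every threshold \<open>N\<close> and both bits \<open>i\<close> in the one column
  \<open>k\<close>.\<close>

definition forces_split :: "((nat \<times> nat) set \<Rightarrow> nat set) \<Rightarrow> condition set" where
  "forces_split W = {q. \<exists>k. \<forall>q' i N. cond q' \<and> extends q' q \<longrightarrow>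
      (\<exists>q''. cond q'' \<and> extends q'' q' \<and> forces W k i N q'')}"

lemma extends_refl: "extends q q"
  by (cases q) auto

lemma extends_trans: "extends a b \<Longrightarrow> extends b c \<Longrightarrow> extends a c"
  by (cases a; cases b; cases c) (auto; blast)

lemma cond_finite_extension:
  assumes "cond (D, V, K)" "finite u"
  shows "cond (D \<union> u, V', K)"
proof -
  have "finite {n. (k, n) \<in> u}" for k
    by (rule finite_subset[of _ "snd ` u"]) (use assms(2) in force)+
  then show ?thesis using assms by (auto simp: image_Un Collect_disj_eq)
qed

text \<open>If a fresh column \<open>k\<close> cannot be kept free for splitting \<open>W\<close>, some bit \<open>i\<close> is never
  realised in column \<open>k\<close> on new elements of \<open>W\<close>; locking the column to \<open>i\<close> makes \<open>W\<close> finite.\<close>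

lemma dense_forces_finite_or_split:
  assumes "cond q"
  shows "\<exists>q'. cond q' \<and> extends q' q \<and> q' \<in> forces_finite W \<union> forces_split W"
proof -
  obtain D V K where q: "q = (D, V, K)" by (cases q)
  have "finite (K \<union> fst ` D)" using assms q by auto
  \<comment> \<open>Column \<open>k\<close> is untouched by \<open>D\<close> and not promised in
    \<open>K\<close>, so it can still either be kept open or be locked.\<close>
  then obtain k where k: "k \<notin> K \<union> fst ` D" using ex_new_if_finite[of "K \<union> fst ` D"] by auto
  have "{n. (k, n) \<in> D} = {}" using k by force
  then have cond_k: "cond (D, V, insert k K)" using assms q by auto
  show ?thesis
  proof (cases "(D, V, insert k K) \<in> forces_split W")
    case True
    with cond_k q show ?thesis by (intro exI[of _ "(D, V, insert k K)"]) auto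
  next
    case False
    then obtain q' i N where q': "cond q'" "extends q' (D, V, insert k K)"
      and no: "\<And>q''. cond q'' \<Longrightarrow> extends q'' q' \<Longrightarrow> \<not> forces W k i N q''"
      unfolding forces_split_def by blast
    obtain D' V' K' where q'_eq: "q' = (D', V', K')" by (cases q')
    \<comment> \<open>Lock column \<open>k\<close>: keep the decided values on \<open>D'\<close> and
      give the bit \<open>i\<close> to every remaining position.\<close>
    define D2 where "D2 = D' \<union> {k} \<times> UNIV"
    define V2 where "V2 = (V' \<inter> D') \<union> {x. i \<and> fst x = k \<and> x \<notin> D'}"
    have fin: "finite {n. (k, n) \<in> D'}" using q' q'_eq by auto
    then obtain b where b: "\<And>n. (k, n) \<in> D' \<Longrightarrow> n \<le> b"
      using finite_nat_set_iff_bounded_le by auto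
    have "{n. near S (\<lambda>S'. n \<in> W S')} \<subseteq> {..max N b}" if S: "S \<inter> D2 = V2 \<inter> D2" for S
    proof (clarsimp, rule ccontr)
      fix n assume n: "near S (\<lambda>S'. n \<in> W S')" "\<not> n \<le> max N b"
      obtain u where u: "finite u" "\<And>S'. S' \<inter> u = S \<inter> u \<Longrightarrow> n \<in> W S'"
        using n(1) unfolding near_def by blast
      have notin: "(k, n) \<notin> D'" using n(2) b by force
      have mem: "(k, n) \<in> S \<longleftrightarrow> i"
      proof -
        have "(k, n) \<in> S \<inter> D2 \<longleftrightarrow> (k, n) \<in> V2 \<inter> D2" using S by simp
        then show ?thesis using notin unfolding D2_def V2_def by simp
      qed
      \<comment> \<open>A large element put into \<open>W S\<close> by the finite part
        \<open>u\<close> would let \<open>q'\<close> be extended by \<open>u\<close> and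
        \<open>(k, n)\<close>, realising the bit \<open>i\<close> after all.\<close>
      let ?q = "(D' \<union> insert (k, n) u, S, K')"
      have "S \<inter> D' = V' \<inter> D'" using S unfolding D2_def V2_def by auto
      then have "extends ?q q'" unfolding q'_eq by auto
      moreover have "cond ?q"
        using cond_finite_extension[of D' V' K' "insert (k, n) u" S] q' q'_eq u(1) by blast
      moreover have "forces W k i N ?q"
        unfolding forces.simps
      proof (intro exI[of _ n] conjI allI impI)
        fix S' assume "S' \<inter> (D' \<union> insert (k, n) u) = S \<inter> (D' \<union> insert (k, n) u)"
        then have "S' \<inter> u = S \<inter> u" by auto
        then show "n \<in> W S'" by (rule u(2))
      qed (use n(2) mem in auto)
      ultimately show False using no by blast
    qed
    then have "(D2, V2, K) \<in> forces_finite W" unfolding forces_finite_def by blast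
    \<comment> \<open>The promises return to \<open>K\<close>: \<open>K'\<close> contains
      \<open>k\<close>, whose column is now locked.\<close>
    moreover have "cond (D2, V2, K)"
    proof -
      have "{n. (k', n) \<in> D2} = {n. (k', n) \<in> D'}" if "k' \<in> K" for k'
        using that k unfolding D2_def by auto
      moreover have "finite (fst ` D2)" using q' q'_eq unfolding D2_def by (auto simp: image_Un)
      ultimately show ?thesis using assms q q' q'_eq by auto
    qed
    moreover have "extends (D2, V2, K) q"
      using q' unfolding q q'_eq D2_def V2_def by auto
    ultimately show ?thesis by blast
  qed
qed

definition family_of :: "(nat \<times> nat) set \<Rightarrow> nat \<Rightarrow> nat set" where
  "family_of S k = {n. (k, n) \<in> S}"

lemma infinite_iff_exceeds: "infinite (A :: nat set) \<longleftrightarrow> (\<forall>N. \<exists>n\<in>A. n > N)"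
  by (auto simp: infinite_nat_iff_unbounded)

text \<open>Every condition has \<open>0 \<in> K\<close>, so column \<open>0\<close> is never locked
  and can be made to split the infinite sets in \<open>\<M>\<close>. Continuity of \<open>W\<close>
  is asked only at \<open>S\<close>, where the computations concerned will be total.\<close>

lemma generic_family_exists:
  assumes "countable \<M>" "countable \<W>"
  obtains S where
    "\<And>I i. I \<in> \<M> \<Longrightarrow> infinite I \<Longrightarrow> infinite {n\<in>I. n \<in> family_of S 0 \<longleftrightarrow> i}"
    "\<And>W. W \<in> \<W> \<Longrightarrow> \<forall>n\<in>W S. near S (\<lambda>S'. n \<in> W S') \<Longrightarrow> infinite (W S)
      \<Longrightarrow> \<not> cohesive (family_of S) (W S)"
proof -
  define spl :: "nat set \<Rightarrow> bool \<Rightarrow> nat \<Rightarrow> condition set" where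
    "spl = (\<lambda>I i N. {(D, V, K). \<exists>n\<in>I. n > N \<and> (0, n) \<in> D \<and> ((0, n) \<in> V \<longleftrightarrow> i)})"
  \<comment> \<open>The splitting column \<open>k\<close> is known only once a condition in
    \<open>forces_split W\<close> has been met. Deciding the forcing relation for every
    \<open>k\<close> keeps the list of dense sets countable and independent of that choice.\<close>
  define dec :: "((nat \<times> nat) set \<Rightarrow> nat set) \<Rightarrow> nat \<Rightarrow> bool \<Rightarrow> nat \<Rightarrow> condition set" where
    "dec = (\<lambda>W k i N. {q. forces W k i N q \<or>
      (\<forall>q'. cond q' \<and> extends q' q \<longrightarrow> \<not> forces W k i N q')})"
  define \<D> where "\<D> = (\<lambda>(I, i, N). spl I i N) ` ({I\<in>\<M>. infinite I} \<times> UNIV \<times> UNIV)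
    \<union> (\<lambda>W. forces_finite W \<union> forces_split W) ` \<W>
    \<union> (\<lambda>(W, k, i, N). dec W k i N) ` (\<W> \<times> UNIV \<times> UNIV \<times> UNIV)"
  have "countable {I\<in>\<M>. infinite I}" using assms(1) by (rule countable_subset[rotated]) auto
  then have "countable \<D>"
    unfolding \<D>_def using assms(2)
    by (intro countable_Un countable_image countable_SIGMA countableI_type) auto
  have dense: "\<exists>c'. cond c' \<and> extends c' c \<and> c' \<in> d" if "d \<in> \<D>" "cond c" for d c
  proof -
    consider I i N where "d = spl I i N" "infinite I"
      | W where "d = forces_finite W \<union> forces_split W"
      | W k i N where "d = dec W k i N"
      using \<open>d \<in> \<D>\<close> unfolding \<D>_def by auto
    then show ?thesis
    proof cases
      case 1
      obtain D V K where c: "c = (D, V, K)" by (cases c)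
      have "finite ({n. (0, n) \<in> D} \<union> {..N})" using \<open>cond c\<close> c by auto
      then obtain n where n: "n \<in> I" "n \<notin> {n. (0, n) \<in> D} \<union> {..N}"
        using 1(2) by (meson finite_subset subsetI)
      let ?V = "V \<inter> D \<union> {x. i \<and> x = (0, n)}"
      have "cond (D \<union> {(0, n)}, ?V, K)"
        by (rule cond_finite_extension) (use \<open>cond c\<close> c in auto)
      moreover have "extends (D \<union> {(0, n)}, ?V, K) c" using n c by auto
      moreover have "(D \<union> {(0, n)}, ?V, K) \<in> d"
        unfolding 1 spl_def using n by (auto intro!: bexI[of _ n])
      ultimately show ?thesis by blast
    next
      case 2
      then show ?thesis using dense_forces_finite_or_split[OF \<open>cond c\<close>] by blast
    next
      case 3
      then show ?thesis
        unfolding dec_def using \<open>cond c\<close> extends_refl[of c] by blast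
    qed
  qed
  have init: "cond ({}, {}, {0})" by simp
  obtain f :: "nat \<Rightarrow> condition" where "f 0 = ({}, {}, {0})" and f: "\<And>n. cond (f n)" "\<And>m n. m \<le> n \<Longrightarrow> extends (f n) (f m)"
    and meet: "\<And>d. d \<in> \<D> \<Longrightarrow> \<exists>n. f n \<in> d"
    by (rule rasiowa_sikorski[where C = cond and r = extends,
        OF \<open>countable \<D>\<close> init extends_refl extends_trans dense]) (assumption | rule that)+
  define S where "S = (\<Union>n. fst (snd (f n)) \<inter> fst (f n))"
  have S: "S \<inter> D = V \<inter> D" if fn: "f n = (D, V, K)" for n D V K
  proof -
    have "x \<in> V" if "x \<in> D" "x \<in> V'" "x \<in> D'" "f m = (D', V', K')" for x m D' V' K'
      using that f(2)[of m n] f(2)[of n m] fn by (cases "m \<le> n") auto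
    then have "S \<inter> D \<subseteq> V" unfolding S_def by (auto, metis prod.collapse)
    moreover have "V \<inter> D \<subseteq> S"
      unfolding S_def using fn UN_upper[of n UNIV "\<lambda>n. fst (snd (f n)) \<inter> fst (f n)"] by simp
    ultimately show ?thesis by blast
  qed
  have forced: "\<exists>m>N. m \<in> W S \<and> (m \<in> family_of S k \<longleftrightarrow> i)" if F: "forces W k i N (f n)" for W k i N n
  proof -
    obtain D V K where fn: "f n = (D, V, K)" by (cases "f n")
    obtain m where m: "m > N" "(k, m) \<in> D" "(k, m) \<in> V \<longleftrightarrow> i" "m \<in> W S"
      using F S[OF fn] unfolding fn forces.simps by blast
    then have "(k, m) \<in> S \<longleftrightarrow> i" using S[OF fn] by blast
    with m show ?thesis unfolding family_of_def by blast
  qed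
  show thesis
  proof
    fix I i assume I: "I \<in> \<M>" "infinite I"
    have "\<exists>n\<in>{n\<in>I. n \<in> family_of S 0 \<longleftrightarrow> i}. n > N" for N
    proof -
      have "spl I i N \<in> \<D>" unfolding \<D>_def using I by auto
      then obtain s where "f s \<in> spl I i N" using meet by blast
      then obtain D V K n where fn: "f s = (D, V, K)"
        and n: "n \<in> I" "n > N" "(0, n) \<in> D" "(0, n) \<in> V \<longleftrightarrow> i"
        unfolding spl_def by (cases "f s") auto
      then have "(0, n) \<in> S \<longleftrightarrow> i" using S[OF fn] by blast
      with n show ?thesis unfolding family_of_def by blast
    qed
    then show "infinite {n\<in>I. n \<in> family_of S 0 \<longleftrightarrow> i}"
      unfolding infinite_iff_exceeds by blast
  next
    fix W assume W: "W \<in> \<W>" "\<forall>n\<in>W S. near S (\<lambda>S'. n \<in> W S')" "infinite (W S)"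
    have "forces_finite W \<union> forces_split W \<in> \<D>" unfolding \<D>_def using W(1) by auto
    then obtain s where s: "f s \<in> forces_finite W \<union> forces_split W" using meet by blast
    have "f s \<notin> forces_finite W"
    proof
      assume "f s \<in> forces_finite W"
      then obtain D V K b where "f s = (D, V, K)"
        and b: "\<And>S. S \<inter> D = V \<inter> D \<Longrightarrow> {n. near S (\<lambda>S'. n \<in> W S')} \<subseteq> {..b}"
        unfolding forces_finite_def by (cases "f s") auto
      then have "W S \<subseteq> {..b}" using S[of s D V K] W(2) b[of S] by blast
      then show False using W(3) finite_subset by blast
    qed
    with s obtain k where k: "\<And>q' i N. cond q' \<Longrightarrow> extends q' (f s) \<Longrightarrow>
        \<exists>q''. cond q'' \<and> extends q'' q' \<and> forces W k i N q''"
      unfolding forces_split_def by blast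
    have ex: "\<exists>m>N. m \<in> W S \<and> (m \<in> family_of S k \<longleftrightarrow> i)" for i N
    proof -
      have "dec W k i N \<in> \<D>"
        unfolding \<D>_def using W(1) by (intro UnI2 image_eqI[of _ _ "(W, k, i, N)"]) auto
      then obtain t where t: "f t \<in> dec W k i N" using meet by blast
      \<comment> \<open>Beyond stage \<open>s\<close> some extension always forces the statement, so
        stage \<open>t\<close> cannot have decided it negatively; a common strengthening of both
        stages shows the conflict.\<close>
      have "forces W k i N (f t)"
      proof (rule ccontr)
        assume no: "\<not> forces W k i N (f t)"
        obtain q'' where "cond q''" "extends q'' (f (max s t))" "forces W k i N q''"
          using k[of "f (max s t)" i N] f by (meson max.cobounded1)
        moreover from this have "extends q'' (f t)"
          using extends_trans f(2)[of t "max s t"] by auto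
        ultimately show False using t no unfolding dec_def by blast
      qed
      then show ?thesis by (rule forced)
    qed
    have "infinite (W S \<inter> family_of S k)" "infinite (W S \<inter> - family_of S k)"
      unfolding infinite_iff_exceeds using ex[of _ True] ex[of _ False] by auto
    then show "\<not> cohesive (family_of S) (W S)" unfolding cohesive_def by blast
  qed
qed

subsection \<open>Accepted labels\<close>

text \<open>\<open>R F n\<close> reads: the finite set \<open>F\<close> carries the label \<open>n\<close>.\<close>

definition accepts :: "(nat set \<Rightarrow> nat \<Rightarrow> bool) \<Rightarrow> nat set \<Rightarrow> nat set \<Rightarrow> nat \<Rightarrow> bool" where
  "accepts R J \<alpha> n \<longleftrightarrow> (\<forall>K\<subseteq>J. infinite K \<longrightarrow> (\<exists>F\<subseteq>\<alpha> \<union> K. finite F \<and> R F n))"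

text \<open>The counterpart of deciding sets in combinatorial forcing. Acceptance passes to infinite
  subsets in any case, so on a deciding \<open>J\<close> it no longer changes under
  shrinking.\<close>

definition deciding :: "(nat set \<Rightarrow> nat \<Rightarrow> bool) \<Rightarrow> nat set \<Rightarrow> bool" where
  "deciding R J \<longleftrightarrow> (\<forall>\<alpha> n K. finite \<alpha> \<longrightarrow> K \<subseteq> J \<longrightarrow> infinite K \<longrightarrow> accepts R K \<alpha> n \<longrightarrow> accepts R J \<alpha> n)"

definition bounded_labels :: "(nat set \<Rightarrow> nat \<Rightarrow> bool) \<Rightarrow> nat set \<Rightarrow> bool" where
  "bounded_labels R J \<longleftrightarrow> (\<exists>b. \<forall>F\<subseteq>J. finite F \<longrightarrow> (\<forall>n. R F n \<longrightarrow> n \<le> b))"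

definition candidates :: "(nat set \<Rightarrow> nat \<Rightarrow> bool) \<Rightarrow> nat set \<Rightarrow> nat set \<Rightarrow> nat \<Rightarrow> nat set" where
  "candidates R J \<alpha> N = {y\<in>J. \<exists>n>N. accepts R J (insert y \<alpha>) n}"

text \<open>One label is attached to each candidate, so that candidates can be sorted by the side on
  which it falls. To rule out new labels, \<open>N\<close> is taken to bound those already accepted
  by \<open>\<alpha>\<close>.\<close>

definition least_label :: "(nat set \<Rightarrow> nat \<Rightarrow> bool) \<Rightarrow> nat set \<Rightarrow> nat set \<Rightarrow> nat \<Rightarrow> nat \<Rightarrow> nat" where
  "least_label R J \<alpha> N y = (LEAST n. n > N \<and> accepts R J (insert y \<alpha>) n)"

lemma least_label:
  assumes "y \<in> candidates R J \<alpha> N"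
  shows "least_label R J \<alpha> N y > N" "accepts R J (insert y \<alpha>) (least_label R J \<alpha> N y)"
proof -
  have "\<exists>n. n > N \<and> accepts R J (insert y \<alpha>) n" using assms unfolding candidates_def by blast
  from LeastI_ex[OF this] show "least_label R J \<alpha> N y > N"
    "accepts R J (insert y \<alpha>) (least_label R J \<alpha> N y)"
    unfolding least_label_def by auto
qed

section \<open>Acceptance under passing to infinite subsets\<close>

lemma accepts_of_label: "F \<subseteq> \<alpha> \<Longrightarrow> finite F \<Longrightarrow> R F n \<Longrightarrow> accepts R J \<alpha> n"
  unfolding accepts_def by blast

text \<open>Acceptance quantifies over infinite sets, so finitely many points of \<open>K\<close>
  outside \<open>J\<close> can be discarded.\<close>

lemma accepts_almost_subset:
  assumes "accepts R J \<alpha> n" "finite (K - J)"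
  shows "accepts R K \<alpha> n"
  unfolding accepts_def
proof (intro allI impI)
  fix L assume "L \<subseteq> K" "infinite L"
  have "L - J \<subseteq> K - J" using \<open>L \<subseteq> K\<close> by blast
  then have "finite (L - J)" using assms(2) finite_subset by blast
  then have "infinite (L \<inter> J)" using \<open>infinite L\<close> by (metis Diff_Diff_Int Diff_infinite_finite)
  then obtain F where "F \<subseteq> \<alpha> \<union> (L \<inter> J)" "finite F" "R F n"
    using assms(1) unfolding accepts_def by (meson inf_le2)
  then show "\<exists>F\<subseteq>\<alpha> \<union> L. finite F \<and> R F n" by blast
qed

text \<open>Diagonal choice: an increasing \<open>g\<close> with \<open>g n \<in> f n\<close> lies
  in each \<open>f n\<close> up to finitely many values.\<close>

lemma pseudo_intersection:
  fixes f :: "nat \<Rightarrow> nat set"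
  assumes inf: "\<And>n. infinite (f n)" and mono: "\<And>m n. m \<le> n \<Longrightarrow> f n \<subseteq> f m"
  obtains J where "infinite J" "J \<subseteq> f 0" "\<And>n. finite (J - f n)"
proof -
  have "\<exists>g. \<forall>n. g n \<in> f n \<and> g n < g (Suc n)"
  proof (rule dependent_nat_choice)
    show "\<exists>x. x \<in> f 0" using inf[of 0] by (metis finite.emptyI ex_in_conv)
    fix x n
    show "\<exists>y. y \<in> f (Suc n) \<and> x < y" using inf[of "Suc n"] unfolding infinite_nat_iff_unbounded by blast
  qed
  then obtain g where g: "\<And>n. g n \<in> f n" "strict_mono g" by (auto simp: strict_mono_Suc_iff)
  show thesis
  proof (rule that)
    show "infinite (range g)" using g(2) by (simp add: range_inj_infinite strict_mono_imp_inj_on)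
    show "range g \<subseteq> f 0" using g(1) mono by blast
    fix n
    have "k < n" if "g k \<notin> f n" for k
      using that g(1)[of k] mono[of n k] by (meson in_mono not_le)
    then have "range g - f n \<subseteq> g ` {..<n}" by auto
    then show "finite (range g - f n)" using finite_surj by blast
  qed
qed

text \<open>Settle the countably many pairs \<open>(\<alpha>, n)\<close> along a decreasing sequence
  of infinite sets. A pseudo-intersection inherits all these decisions, since acceptance ignores
  finite differences.\<close>

lemma deciding_exists:
  assumes "infinite I"
  shows "\<exists>J\<subseteq>I. infinite J \<and> deciding R J"
proof -
  define dec where "dec = (\<lambda>(\<alpha>, n). {J. accepts R J \<alpha> n \<or> (\<forall>K\<subseteq>J. infinite K \<longrightarrow> \<not> accepts R K \<alpha> n)})"
  let ?\<D> = "dec ` (Collect finite \<times> UNIV)"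
  have count: "countable ?\<D>"
    by (intro countable_image countable_SIGMA countable_Collect_finite countableI_type)
  have dense: "\<exists>c'. (infinite c' \<and> c' \<subseteq> I) \<and> c' \<subseteq> c \<and> c' \<in> d"
    if "d \<in> ?\<D>" "infinite c \<and> c \<subseteq> I" for d c
  proof -
    obtain \<alpha> n where d: "d = dec (\<alpha>, n)" using \<open>d \<in> ?\<D>\<close> by blast
    show ?thesis
    proof (cases "\<forall>K\<subseteq>c. infinite K \<longrightarrow> \<not> accepts R K \<alpha> n")
      case True
      then show ?thesis using that(2) unfolding d dec_def by (intro exI[of _ c]) simp
    next
      case False
      then obtain K where "K \<subseteq> c" "infinite K" "accepts R K \<alpha> n" by blast
      then show ?thesis using that(2) unfolding d dec_def by (intro exI[of _ K]) auto
    qed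
  qed
  have init: "infinite I \<and> I \<subseteq> I" using assms by simp
  obtain f :: "nat \<Rightarrow> nat set" where f0: "f 0 = I" and f: "\<And>n. infinite (f n) \<and> f n \<subseteq> I"
    and mono: "\<And>m n. m \<le> n \<Longrightarrow> f n \<subseteq> f m" and meet: "\<And>d. d \<in> ?\<D> \<Longrightarrow> \<exists>n. f n \<in> d"
    by (rule rasiowa_sikorski[where C = "\<lambda>J. infinite J \<and> J \<subseteq> I" and r = "(\<subseteq>)",
        OF count init subset_refl subset_trans dense]) (assumption | rule that)+
  obtain J where J: "infinite J" "J \<subseteq> I" "\<And>n. finite (J - f n)"
    using pseudo_intersection[of f] f mono f0 by metis
  have "accepts R J \<alpha> n" if \<alpha>: "finite \<alpha>" and K: "K \<subseteq> J" "infinite K" "accepts R K \<alpha> n" for \<alpha> n K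
  proof -
    obtain t where t: "f t \<in> dec (\<alpha>, n)" using meet[of "dec (\<alpha>, n)"] \<alpha> by blast
    have fin: "finite (K - f t)" using J(3)[of t] K(1) by (meson Diff_mono finite_subset order_refl)
    have "accepts R (K \<inter> f t) \<alpha> n"
      by (rule accepts_almost_subset[OF K(3)]) (metis Int_lower1 Diff_eq_empty_iff finite.emptyI)
    moreover have "infinite (K \<inter> f t)" using K(2) fin by (metis Diff_Diff_Int Diff_infinite_finite)
    ultimately have "accepts R (f t) \<alpha> n" using t unfolding dec_def by auto
    then show ?thesis using J(3) accepts_almost_subset by blast
  qed
  then show ?thesis using J(1,2) unfolding deciding_def by blast
qed

text \<open>If infinitely many \<open>y\<close> accepted \<open>n\<close>, the set of these
  \<open>y\<close> would accept \<open>n\<close> already for \<open>\<alpha>\<close>, because any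
  infinite subset of it supplies such a \<open>y\<close> itself. As \<open>J\<close> is deciding,
  this carries back to \<open>J\<close>.\<close>

lemma deciding_finite:
  assumes "deciding R J" "finite \<alpha>" "\<not> accepts R J \<alpha> n"
  shows "finite {y\<in>J. accepts R J (insert y \<alpha>) n}" (is "finite ?Q")
proof (rule ccontr)
  assume inf: "infinite ?Q"
  have "accepts R ?Q \<alpha> n"
    unfolding accepts_def[of R ?Q]
  proof (intro allI impI)
    fix K assume K: "K \<subseteq> ?Q" "infinite K"
    then obtain y where y: "y \<in> K" by (metis finite.emptyI ex_in_conv)
    then have "accepts R J (insert y \<alpha>) n" using K(1) by auto
    moreover have "K \<subseteq> J" using K(1) by auto
    ultimately obtain F where "F \<subseteq> insert y \<alpha> \<union> K" "finite F" "R F n"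
      using K(2) unfolding accepts_def by meson
    then show "\<exists>F\<subseteq>\<alpha> \<union> K. finite F \<and> R F n" using y by blast
  qed
  moreover have "?Q \<subseteq> J" by auto
  ultimately show False using assms inf unfolding deciding_def by blast
qed

subsection \<open>Greedy homogeneous sets\<close>

text \<open>Points are examined in increasing order, so membership of \<open>n\<close> depends only
  on \<open>C\<close> and \<open>col\<close> up to \<open>n\<close>. This locality later makes the
  greedy set continuous in the family.\<close>

function greedy :: "(nat \<Rightarrow> nat \<Rightarrow> nat) \<Rightarrow> nat \<Rightarrow> nat set \<Rightarrow> nat \<Rightarrow> bool" where
  "greedy col j C n \<longleftrightarrow> n \<in> C \<and> (\<forall>a\<in>{..<n}. greedy col j C a \<longrightarrow> col a n = j)"
  by auto
termination by (relation "measure (\<lambda>(col, j, C, n). n)") auto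

declare greedy.simps [simp del]

lemma greedy_cong:
  assumes "\<And>a b. a < b \<Longrightarrow> b \<le> n \<Longrightarrow> col a b = col' a b" "\<And>a. a \<le> n \<Longrightarrow> a \<in> C \<longleftrightarrow> a \<in> C'"
  shows "greedy col j C n \<longleftrightarrow> greedy col' j C' n"
  using assms
proof (induction n rule: less_induct)
  case (less n)
  then show ?case by (subst (1 2) greedy.simps) auto
qed

locale limit_colour =
  fixes col :: "nat \<Rightarrow> nat \<Rightarrow> nat" and j :: nat and A :: "nat set"
  assumes lim: "x \<in> A \<Longrightarrow> \<forall>\<^sub>F y in sequentially. col x y = j"
begin

definition good :: "nat set \<Rightarrow> bool" where
  "good G \<longleftrightarrow> G \<subseteq> A \<and> (\<forall>x\<in>G. \<forall>y\<in>G. x < y \<longrightarrow> col x y = j)"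

lemma good_subset: "good G \<Longrightarrow> F \<subseteq> G \<Longrightarrow> good F"
  unfolding good_def by blast

lemma eventually_extends:
  assumes "finite G" "G \<subseteq> A"
  shows "\<exists>m. \<forall>y\<ge>m. \<forall>x\<in>G. x < y \<and> col x y = j"
proof -
  have "\<forall>\<^sub>F y in sequentially. \<forall>x\<in>G. x < y \<and> col x y = j"
    using assms lim by (intro eventually_ball_finite) (auto intro!: eventually_conj eventually_gt_at_top)
  then show ?thesis unfolding eventually_sequentially .
qed

lemma infinite_extending:
  assumes "infinite C" "finite G" "G \<subseteq> A"
  shows "infinite {y\<in>C. \<forall>x\<in>G. x < y \<and> col x y = j}"
proof -
  obtain m where m: "\<And>y x. y \<ge> m \<Longrightarrow> x \<in> G \<Longrightarrow> x < y \<and> col x y = j"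
    using eventually_extends[OF assms(2,3)] by blast
  have "infinite (C - {..<m})" using assms(1) by (simp add: Diff_infinite_finite)
  moreover have "C - {..<m} \<subseteq> {y\<in>C. \<forall>x\<in>G. x < y \<and> col x y = j}"
    using m by auto
  ultimately show ?thesis using finite_subset by blast
qed

lemma good_union:
  assumes "good G" "good B" and before: "\<And>x y. x \<in> G \<Longrightarrow> y \<in> B \<Longrightarrow> x < y \<and> col x y = j"
  shows "good (G \<union> B)"
  unfolding good_def
proof (intro conjI ballI impI)
  show "G \<union> B \<subseteq> A" using assms(1,2) unfolding good_def by simp
  fix x y assume xy: "x \<in> G \<union> B" "y \<in> G \<union> B" "x < y"
  show "col x y = j"
  proof (cases "x \<in> G")
    case True
    then show ?thesis using xy assms(1) before[of x y] unfolding good_def by blast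
  next
    case False
    then have "y \<notin> G" using xy before[of y x] by force
    then show ?thesis using False xy assms(2) unfolding good_def by blast
  qed
qed

lemma good_insert:
  assumes "good G" "y \<in> A" "\<forall>x\<in>G. x < y \<and> col x y = j"
  shows "good (insert y G)"
proof -
  have "good {y}" using assms(2) unfolding good_def by simp
  with assms(1) have "good (G \<union> {y})"
    by (rule good_union) (use assms(3) in blast)
  then show ?thesis by simp
qed

lemma greedy_subset: "Collect (greedy col j C) \<subseteq> C"
  by (auto dest: iffD1[OF greedy.simps])

lemma good_greedy:
  assumes "C \<subseteq> A"
  shows "good (Collect (greedy col j C))"
  unfolding good_def
proof (intro conjI ballI impI)
  show "Collect (greedy col j C) \<subseteq> A" using greedy_subset assms by (rule order_trans)
  fix x y assume "x \<in> Collect (greedy col j C)" "y \<in> Collect (greedy col j C)" "x < y"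
  then show "col x y = j" using greedy.simps[of col j C y] by simp
qed

lemma infinite_greedy:
  assumes "infinite C" "C \<subseteq> A"
  shows "infinite (Collect (greedy col j C))"
proof
  assume fin: "finite (Collect (greedy col j C))"
  then have "infinite {y\<in>C. \<forall>x\<in>Collect (greedy col j C). x < y \<and> col x y = j}"
    using infinite_extending assms greedy_subset by (meson order_trans)
  then obtain y where y: "y \<in> C" "\<And>x. greedy col j C x \<Longrightarrow> x < y \<and> col x y = j"
    using not_finite_existsD by auto
  then have "greedy col j C y" by (subst greedy.simps) auto
  then show False using y(2) by blast
qed

lemma good_extension:
  assumes "infinite C" "C \<subseteq> A" "finite G" "good G"
  obtains B where "B \<subseteq> C" "infinite B" "good (G \<union> B)"
proof -
  let ?C = "{y\<in>C. \<forall>x\<in>G. x < y \<and> col x y = j}"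
  let ?B = "Collect (greedy col j ?C)"
  have "?C \<subseteq> A" using assms(2) by auto
  have "infinite ?B"
    using infinite_greedy[OF infinite_extending[OF assms(1,3)] \<open>?C \<subseteq> A\<close>] assms(4)
    unfolding good_def by blast
  moreover have sub: "?B \<subseteq> ?C" by (rule greedy_subset)
  moreover have "good (G \<union> ?B)"
  proof -
    have before: "x < y \<and> col x y = j" if "x \<in> G" "y \<in> ?B" for x y
      using sub that by blast
    show ?thesis by (rule good_union[OF assms(4) good_greedy[OF \<open>?C \<subseteq> A\<close>] before])
  qed
  ultimately show thesis using that[of ?B] by blast
qed

text \<open>If no such \<open>F\<close> exists, the splitting assumptions bound the labels accepted by good sets
  \<open>\<alpha>\<close>, and then extending \<open>\<alpha>\<close> by almost any \<open>y\<close> yields no new accepted label. Iterating this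
  builds an infinite good set with bounded labels.\<close>

lemma labelled_good_set:
  assumes E: "finite E" "good E" and dec: "deciding R J" and hit: "infinite (A \<inter> J)"
    and split: "\<And>\<alpha>. finite \<alpha> \<Longrightarrow> infinite {n. accepts R J \<alpha> n} \<Longrightarrow> infinite {n. accepts R J \<alpha> n \<and> n \<in> T}"
    and hit_split: "\<And>\<alpha> m. finite \<alpha> \<Longrightarrow> infinite (least_label R J \<alpha> m ` candidates R J \<alpha> m)
      \<Longrightarrow> infinite {y\<in>A \<inter> candidates R J \<alpha> m. least_label R J \<alpha> m y \<in> T}"
    and unbounded: "\<And>K. K \<subseteq> J \<Longrightarrow> infinite K \<Longrightarrow> \<not> bounded_labels R K"
  shows "\<exists>F\<subseteq>J. finite F \<and> good (E \<union> F) \<and> (\<exists>n>N. n \<in> T \<and> R F n)"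
proof (rule ccontr)
  assume none: "\<not> ?thesis"
  let ?L = "\<lambda>\<alpha>. {n. accepts R J \<alpha> n}"
  define P where "P = (\<lambda>\<alpha>. finite \<alpha> \<and> \<alpha> \<subseteq> J \<and> good (E \<union> \<alpha>))"
  \<comment> \<open>Inside \<open>A \<inter> J\<close> the good set
    \<open>E \<union> \<alpha>\<close> grows by an infinite good \<open>B\<close>. Acceptance finds
    \<open>F\<close> in \<open>\<alpha> \<union> B\<close>, which would be the forbidden witness if
    \<open>n > N\<close>.\<close>
  have le_N: "n \<le> N" if \<alpha>: "P \<alpha>" and n: "accepts R J \<alpha> n" "n \<in> T" for \<alpha> n
  proof -
    have fin: "finite (E \<union> \<alpha>)" and gd: "good (E \<union> \<alpha>)" using \<alpha> E(1) unfolding P_def by auto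
    obtain B where B: "B \<subseteq> A \<inter> J" "infinite B" "good (E \<union> \<alpha> \<union> B)"
      by (rule good_extension[OF hit _ fin gd]) (auto intro: that)
    then obtain F where F: "F \<subseteq> \<alpha> \<union> B" "finite F" "R F n"
      using n(1) unfolding accepts_def by (metis le_inf_iff)
    have "good (E \<union> F)" using good_subset[OF B(3)] F(1) by blast
    moreover have "F \<subseteq> J" using F(1) B(1) \<alpha> unfolding P_def by blast
    ultimately show ?thesis using none F(2,3) n(2) not_le by blast
  qed
  have fin_L: "finite (?L \<alpha>)" if "P \<alpha>" for \<alpha>
  proof -
    have "{n. accepts R J \<alpha> n \<and> n \<in> T} \<subseteq> {..N}" using le_N[OF that] by auto
    then have "finite {n. accepts R J \<alpha> n \<and> n \<in> T}" using finite_subset by blast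
    then show ?thesis using split that unfolding P_def by blast
  qed
  have good_candidates: "infinite {y\<in>C. P (insert y \<alpha>)}" if C: "infinite C" "C \<subseteq> A \<inter> J" and "P \<alpha>" for C \<alpha>
  proof -
    have "finite (E \<union> \<alpha>)" "E \<union> \<alpha> \<subseteq> A" using \<open>P \<alpha>\<close> E unfolding P_def good_def by auto
    then have "infinite {y\<in>C. \<forall>x\<in>E \<union> \<alpha>. x < y \<and> col x y = j}"
      by (rule infinite_extending[OF C(1)])
    moreover have "P (insert y \<alpha>)" if "y \<in> C" "\<forall>x\<in>E \<union> \<alpha>. x < y \<and> col x y = j" for y
      using good_insert[of "E \<union> \<alpha>" y] that C(2) \<open>P \<alpha>\<close> unfolding P_def by auto
    then have "{y\<in>C. \<forall>x\<in>E \<union> \<alpha>. x < y \<and> col x y = j} \<subseteq> {y\<in>C. P (insert y \<alpha>)}" by blast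
    ultimately show ?thesis using finite_subset by blast
  qed
  \<comment> \<open>A new label is either above \<open>m\<close>, which makes \<open>y\<close> a
    candidate, or one of the finitely many unaccepted labels up to \<open>m\<close>. Only finitely
    many \<open>y\<close> arise in each way.\<close>
  have no_new: "finite {y\<in>J. \<not> ?L (insert y \<alpha>) \<subseteq> ?L \<alpha>}" if P\<alpha>: "P \<alpha>" for \<alpha>
  proof -
    have \<alpha>: "finite \<alpha>" using P\<alpha> unfolding P_def by simp
    obtain m where m: "m \<ge> N" "\<And>n. accepts R J \<alpha> n \<Longrightarrow> n \<le> m"
    proof -
      obtain b where "\<And>n. accepts R J \<alpha> n \<Longrightarrow> n \<le> b"
        using fin_L[OF P\<alpha>] unfolding finite_nat_set_iff_bounded_le by blast
      then show thesis using that[of "max N b"] by (simp add: le_max_iff_disj)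
    qed
    let ?D = "candidates R J \<alpha> m" and ?l = "least_label R J \<alpha> m"
    \<comment> \<open>An infinite range of least labels would yield a candidate \<open>y\<close>
      with \<open>P (insert y \<alpha>)\<close> and a label above \<open>N\<close> in
      \<open>T\<close>, which \<open>le_N\<close> forbids.\<close>
    have fin_img: "finite (?l ` ?D)"
    proof (rule ccontr)
      assume "infinite (?l ` ?D)"
      from hit_split[OF \<alpha> this] have "infinite {y\<in>A \<inter> ?D. ?l y \<in> T}" .
      moreover have "{y\<in>A \<inter> ?D. ?l y \<in> T} \<subseteq> A \<inter> J" unfolding candidates_def by auto
      ultimately have "infinite {y\<in>{y\<in>A \<inter> ?D. ?l y \<in> T}. P (insert y \<alpha>)}"
        using good_candidates[OF _ _ P\<alpha>] by blast
      then obtain y where "y \<in> {y\<in>{y\<in>A \<inter> ?D. ?l y \<in> T}. P (insert y \<alpha>)}"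
        by (metis finite.emptyI ex_in_conv)
      then have y: "y \<in> ?D" "?l y \<in> T" "P (insert y \<alpha>)" by auto
      from le_N[OF y(3) least_label(2)[OF y(1)] y(2)] least_label(1)[OF y(1)] m(1)
      show False by simp
    qed
    \<comment> \<open>With finitely many least labels, infinitely many candidates would share one;
      it exceeds \<open>m\<close>, so \<open>\<alpha>\<close> does not accept it, against
      \<open>deciding_finite\<close>.\<close>
    have "finite ?D"
    proof (rule ccontr)
      assume "infinite ?D"
      from pigeonhole_infinite[OF this fin_img] obtain z
        where z: "z \<in> ?D" "infinite {y\<in>?D. ?l y = ?l z}" by blast
      have "\<not> accepts R J \<alpha> (?l z)" using least_label(1)[OF z(1)] m(2)[of "?l z"] by force
      from deciding_finite[OF dec \<alpha> this] have "finite {y\<in>J. accepts R J (insert y \<alpha>) (?l z)}" .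
      moreover have "{y\<in>?D. ?l y = ?l z} \<subseteq> {y\<in>J. accepts R J (insert y \<alpha>) (?l z)}"
      proof clarify
        fix y assume y: "y \<in> ?D" "?l y = ?l z"
        then show "y \<in> J \<and> accepts R J (insert y \<alpha>) (?l z)"
          using least_label(2)[OF y(1)] unfolding candidates_def by simp
      qed
      ultimately show False using z(2) finite_subset by blast
    qed
    moreover have "finite {y\<in>J. accepts R J (insert y \<alpha>) n}" if "n \<in> {..m} - ?L \<alpha>" for n
      using deciding_finite[OF dec \<alpha>] that by auto
    then have "finite (\<Union>n\<in>{..m} - ?L \<alpha>. {y\<in>J. accepts R J (insert y \<alpha>) n})" by auto
    moreover have "{y\<in>J. \<not> ?L (insert y \<alpha>) \<subseteq> ?L \<alpha>} \<subseteq>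
        ?D \<union> (\<Union>n\<in>{..m} - ?L \<alpha>. {y\<in>J. accepts R J (insert y \<alpha>) n})"
    proof (rule subsetI)
      fix y assume "y \<in> {y\<in>J. \<not> ?L (insert y \<alpha>) \<subseteq> ?L \<alpha>}"
      then obtain n where y: "y \<in> J" and n: "accepts R J (insert y \<alpha>) n" "\<not> accepts R J \<alpha> n"
        by auto
      show "y \<in> ?D \<union> (\<Union>n\<in>{..m} - ?L \<alpha>. {y\<in>J. accepts R J (insert y \<alpha>) n})"
      proof (cases "n > m")
        case True
        then have "y \<in> ?D" using y n(1) unfolding candidates_def by blast
        then show ?thesis by simp
      next
        case False
        then have "n \<in> {..m} - ?L \<alpha>" using n(2) by simp
        then show ?thesis using y n(1) by blast
      qed
    qed
    ultimately show ?thesis using finite_subset by blast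
  qed
  \<comment> \<open>Grow \<open>\<alpha>\<close> one point at a time, avoiding the finitely many
    points that bring new labels; the accepted labels stay among those of the empty set.\<close>
  have "\<exists>f. \<forall>n. (P (f n) \<and> ?L (f n) \<subseteq> ?L {}) \<and> (f n \<subset> f (Suc n))"
  proof (rule dependent_nat_choice)
    show "\<exists>\<alpha>. P \<alpha> \<and> ?L \<alpha> \<subseteq> ?L {}" using E unfolding P_def by (intro exI[of _ "{}"]) auto
    fix \<alpha> :: "nat set" and n :: nat assume \<alpha>: "P \<alpha> \<and> ?L \<alpha> \<subseteq> ?L {}"
    then have "finite (\<alpha> \<union> {y\<in>J. \<not> ?L (insert y \<alpha>) \<subseteq> ?L \<alpha>})" using no_new unfolding P_def by blast
    moreover have "infinite {y\<in>A \<inter> J. P (insert y \<alpha>)}" using good_candidates[OF hit] \<alpha> by blast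
    ultimately obtain y where "y \<in> {y\<in>A \<inter> J. P (insert y \<alpha>)}" "y \<notin> \<alpha> \<union> {y\<in>J. \<not> ?L (insert y \<alpha>) \<subseteq> ?L \<alpha>}"
      by (meson finite_subset subsetI)
    then show "\<exists>\<beta>. (P \<beta> \<and> ?L \<beta> \<subseteq> ?L {}) \<and> \<alpha> \<subset> \<beta>"
      using \<alpha> by (intro exI[of _ "insert y \<alpha>"]) auto
  qed
  then obtain f where "\<forall>n. (P (f n) \<and> ?L (f n) \<subseteq> ?L {}) \<and> (f n \<subset> f (Suc n))" ..
  then have f: "P (f n)" "?L (f n) \<subseteq> ?L {}" "f n \<subset> f (Suc n)" for n by simp_all
  let ?B = "\<Union>(range f)"
  have mono: "mono f" using f(3) by (simp add: mono_iff_le_Suc less_imp_le)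
  have "inj f" using f(3) by (intro strict_mono_imp_inj_on) (simp add: strict_mono_Suc_iff)
  then have "infinite (range f)" by (rule range_inj_infinite)
  moreover have "range f \<subseteq> Pow ?B" by blast
  ultimately have "infinite ?B" using finite_subset finite_Pow_iff by metis
  moreover have "?B \<subseteq> J" using f(1) unfolding P_def by blast
  \<comment> \<open>A finite part of the union lies in some stage, and its label is accepted there,
    hence already by the empty set.\<close>
  moreover have "bounded_labels R ?B"
  proof -
    have "P {}" using E unfolding P_def by simp
    then obtain b where b: "\<And>n. accepts R J {} n \<Longrightarrow> n \<le> b"
      using fin_L finite_nat_set_iff_bounded_le by (metis mem_Collect_eq)
    have "n \<le> b" if F: "F \<subseteq> ?B" "finite F" "R F n" for F n
    proof -
      have "\<exists>k. F \<subseteq> f k"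
        using F(2,1)
      proof (induction F)
        case (insert x F)
        then obtain k l where "F \<subseteq> f k" "x \<in> f l" by auto
        then have "insert x F \<subseteq> f (max k l)"
          using monoD[OF mono, of k "max k l"] monoD[OF mono, of l "max k l"] by auto
        then show ?case by blast
      qed simp
      then obtain k where "F \<subseteq> f k" by blast
      then have "accepts R J (f k) n" using F(2,3) accepts_of_label by blast
      then show ?thesis using f(2) b by blast
    qed
    then show ?thesis unfolding bounded_labels_def by blast
  qed
  ultimately show False using unbounded by blast
qed

end

subsection \<open>Reservoirs and homogeneous sets\<close>

definition labels :: "nat set \<Rightarrow> prog \<Rightarrow> nat set \<Rightarrow> nat \<Rightarrow> bool" where
  "labels E p F n \<longleftrightarrow> computes (E \<union> F) p [n] 1"

text \<open>Closure is phrased as reflection: a witness existing among all infinite subsets exists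
  inside \<open>\<M>\<close>. Sets of labels are included as well, so that column \<open>0\<close>
  will split them when they are infinite.\<close>

definition reservoirs :: "nat set set \<Rightarrow> bool" where
  "reservoirs \<M> \<longleftrightarrow> UNIV \<in> \<M> \<and> (\<forall>I\<in>\<M>. \<forall>m. {y\<in>I. y > m} \<in> \<M>) \<and>
    (\<forall>I\<in>\<M>. \<forall>E p. finite E \<longrightarrow>
      ((\<exists>J\<subseteq>I. infinite J \<and> deciding (labels E p) J)
        \<longrightarrow> (\<exists>J\<in>\<M>. J \<subseteq> I \<and> infinite J \<and> deciding (labels E p) J)) \<and>
      ((\<exists>J\<subseteq>I. infinite J \<and> bounded_labels (labels E p) J)
        \<longrightarrow> (\<exists>J\<in>\<M>. J \<subseteq> I \<and> infinite J \<and> bounded_labels (labels E p) J)) \<and>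
      (\<forall>\<alpha>. finite \<alpha> \<longrightarrow> {n. accepts (labels E p) I \<alpha> n} \<in> \<M> \<and>
        (\<forall>m. least_label (labels E p) I \<alpha> m ` candidates (labels E p) I \<alpha> m \<in> \<M>)))"

lemma countable_closure:
  assumes "countable \<F>"
  obtains \<M> where "countable \<M>" "x \<in> \<M>" "\<And>f y. f \<in> \<F> \<Longrightarrow> y \<in> \<M> \<Longrightarrow> f y \<in> \<M>"
proof
  let ?M = "(\<lambda>fs. foldr (\<lambda>f. f) fs x) ` lists \<F>"
  show "countable ?M" using assms by (intro countable_image countable_lists)
  show "x \<in> ?M" by (rule image_eqI[of _ _ "[]"]) auto
  fix f y assume "f \<in> \<F>" "y \<in> ?M"
  then obtain fs where "fs \<in> lists \<F>" "y = foldr (\<lambda>f. f) fs x" by blast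
  then show "f y \<in> ?M" using \<open>f \<in> \<F>\<close> by (intro image_eqI[of _ _ "f # fs"]) auto
qed

lemma reservoirs_exist:
  obtains \<M> where "countable \<M>" "reservoirs \<M>"
proof -
  let ?Fin = "Collect finite :: nat set set"
  \<comment> \<open>Without a witness, \<open>SOME\<close> returns an arbitrary set, which does no
    harm in a closure.\<close>
  define pick :: "(nat set \<Rightarrow> bool) \<Rightarrow> nat set \<Rightarrow> nat set" where
    "pick = (\<lambda>P I. SOME J. J \<subseteq> I \<and> infinite J \<and> P J)"
  define tails :: "nat \<Rightarrow> nat set \<Rightarrow> nat set" where "tails = (\<lambda>m I. {y\<in>I. y > m})"
  define labs where "labs = (\<lambda>(E, p, \<alpha>) I. {n. accepts (labels E p) I \<alpha> n})"
  define leasts where "leasts = (\<lambda>(E, p, \<alpha>, m) I.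
    least_label (labels E p) I \<alpha> m ` candidates (labels E p) I \<alpha> m)"
  define \<F> where "\<F> = range tails
    \<union> (\<lambda>(E, p). pick (deciding (labels E p))) ` (?Fin \<times> UNIV)
    \<union> (\<lambda>(E, p). pick (bounded_labels (labels E p))) ` (?Fin \<times> UNIV)
    \<union> labs ` (?Fin \<times> UNIV \<times> ?Fin) \<union> leasts ` (?Fin \<times> UNIV \<times> ?Fin \<times> UNIV)"
  have "countable \<F>"
    unfolding \<F>_def
    by (intro countable_Un countable_image countable_SIGMA countable_Collect_finite countableI_type)
  then obtain \<M> where \<M>: "countable \<M>" "UNIV \<in> \<M>" and closed: "\<And>f y. f \<in> \<F> \<Longrightarrow> y \<in> \<M> \<Longrightarrow> f y \<in> \<M>"
    using countable_closure by metis
  have chosen: "\<exists>J\<in>\<M>. J \<subseteq> I \<and> infinite J \<and> P J"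
    if "pick P \<in> \<F>" "I \<in> \<M>" "\<exists>J\<subseteq>I. infinite J \<and> P J" for P I
  proof -
    have "pick P I \<subseteq> I \<and> infinite (pick P I) \<and> P (pick P I)"
      unfolding pick_def using that(3) by (rule someI2_ex) blast
    then show ?thesis using closed[OF that(1,2)] by blast
  qed
  have "reservoirs \<M>"
    unfolding reservoirs_def
  proof (intro conjI ballI allI impI)
    fix I m assume "I \<in> \<M>"
    then show "{y\<in>I. y > m} \<in> \<M>" using closed[of "tails m" I] unfolding \<F>_def tails_def by blast
  next
    fix I E p assume *: "I \<in> \<M>" "finite (E :: nat set)" "\<exists>J\<subseteq>I. infinite J \<and> deciding (labels E p) J"
    have "pick (deciding (labels E p)) \<in> \<F>" unfolding \<F>_def using *(2) by auto
    from chosen[OF this *(1,3)] show "\<exists>J\<in>\<M>. J \<subseteq> I \<and> infinite J \<and> deciding (labels E p) J" .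
  next
    fix I E p assume *: "I \<in> \<M>" "finite (E :: nat set)" "\<exists>J\<subseteq>I. infinite J \<and> bounded_labels (labels E p) J"
    have "pick (bounded_labels (labels E p)) \<in> \<F>" unfolding \<F>_def using *(2) by auto
    from chosen[OF this *(1,3)] show "\<exists>J\<in>\<M>. J \<subseteq> I \<and> infinite J \<and> bounded_labels (labels E p) J" .
  next
    fix I E p \<alpha> assume *: "I \<in> \<M>" "finite (E :: nat set)" "finite (\<alpha> :: nat set)"
    have "labs (E, p, \<alpha>) \<in> \<F>" unfolding \<F>_def using * by (intro UnI1[OF UnI2] imageI) auto
    from closed[OF this *(1)] show "{n. accepts (labels E p) I \<alpha> n} \<in> \<M>" unfolding labs_def by simp
    fix m
    have "leasts (E, p, \<alpha>, m) \<in> \<F>" unfolding \<F>_def using * by (intro UnI2 imageI) auto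
    from closed[OF this *(1)]
    show "least_label (labels E p) I \<alpha> m ` candidates (labels E p) I \<alpha> m \<in> \<M>"
      unfolding leasts_def by simp
  qed (rule \<M>(2))
  with \<M>(1) show thesis by (rule that)
qed

text \<open>These sets depend on \<open>U\<close>, so they cannot be put into the closure
  \<open>\<M>\<close>, which is fixed before the family. Membership of \<open>y\<close> depends on
  the single bit of \<open>U\<close> at its least label.\<close>

definition selected :: "nat set \<Rightarrow> prog \<Rightarrow> nat set \<Rightarrow> nat set \<Rightarrow> nat \<Rightarrow> bool \<Rightarrow> nat set \<Rightarrow> nat set" where
  "selected E p I \<alpha> m i U =
    {y \<in> candidates (labels E p) I \<alpha> m. least_label (labels E p) I \<alpha> m y \<in> U \<longleftrightarrow> i}"

text \<open>\<open>split\<close> will come from the genericity of column \<open>0\<close>;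
  \<open>hit\<close> and \<open>hit_selected\<close> will come from the absence of solutions in
  \<open>Y\<close>.\<close>

locale hitting_colour = limit_colour +
  fixes \<M> :: "nat set set" and U :: "nat set"
  assumes reservoirs: "reservoirs \<M>"
    and split: "I \<in> \<M> \<Longrightarrow> infinite I \<Longrightarrow> infinite {n\<in>I. n \<in> U \<longleftrightarrow> i}"
    and hit: "I \<in> \<M> \<Longrightarrow> infinite I \<Longrightarrow> infinite (A \<inter> I)"
    and hit_selected: "I \<in> \<M> \<Longrightarrow> finite E \<Longrightarrow> finite \<alpha> \<Longrightarrow> infinite (selected E p I \<alpha> m i U)
      \<Longrightarrow> infinite (A \<inter> selected E p I \<alpha> m i U)"
begin

text \<open>On a deciding \<open>J\<close> in \<open>\<M>\<close>, \<open>labelled_good_set\<close>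
  produces \<open>F\<close> unless some infinite \<open>K \<subseteq> J\<close> has bounded labels;
  reflection then finds such a set in \<open>\<M>\<close>.\<close>

lemma bounded_or_split:
  assumes E: "finite E" "good E" and I: "I \<in> \<M>" "infinite I"
  shows "(\<exists>J\<in>\<M>. J \<subseteq> I \<and> infinite J \<and> bounded_labels (labels E p) J)
    \<or> (\<exists>F\<subseteq>I. finite F \<and> good (E \<union> F) \<and> (\<exists>n>N. (n \<in> U \<longleftrightarrow> i) \<and> labels E p F n))"
proof (rule disjCI)
  let ?R = "labels E p" and ?T = "{n. n \<in> U \<longleftrightarrow> i}"
  assume none: "\<not> (\<exists>F\<subseteq>I. finite F \<and> good (E \<union> F) \<and> (\<exists>n>N. (n \<in> U \<longleftrightarrow> i) \<and> ?R F n))"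
  obtain J where J: "J \<in> \<M>" "J \<subseteq> I" "infinite J" "deciding ?R J"
    using reservoirs I(1) E(1) deciding_exists[OF I(2), of ?R] unfolding reservoirs_def by meson
  have accepted: "{n. accepts ?R J \<alpha> n} \<in> \<M>"
    and least: "least_label ?R J \<alpha> m ` candidates ?R J \<alpha> m \<in> \<M>" if "finite \<alpha>" for \<alpha> m
    using reservoirs J(1) E(1) that unfolding reservoirs_def by blast+
  have hit_least: "infinite {y\<in>A \<inter> candidates ?R J \<alpha> m. least_label ?R J \<alpha> m y \<in> ?T}"
    if \<alpha>: "finite \<alpha>" and inf: "infinite (least_label ?R J \<alpha> m ` candidates ?R J \<alpha> m)" for \<alpha> m
  proof -
    let ?l = "least_label ?R J \<alpha> m"
    \<comment> \<open>Splitting is applied to the labels, not to the points: infinitely many least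
      labels on side \<open>i\<close> need infinitely many selected points.\<close>
    have "infinite {n \<in> ?l ` candidates ?R J \<alpha> m. n \<in> U \<longleftrightarrow> i}"
      by (rule split[OF least[OF \<alpha>] inf])
    moreover have "{n \<in> ?l ` candidates ?R J \<alpha> m. n \<in> U \<longleftrightarrow> i} = ?l ` selected E p J \<alpha> m i U"
      unfolding selected_def by blast
    ultimately have "infinite (selected E p J \<alpha> m i U)" by auto
    from hit_selected[OF J(1) E(1) \<alpha> this] have "infinite (A \<inter> selected E p J \<alpha> m i U)" .
    moreover have "A \<inter> selected E p J \<alpha> m i U = {y\<in>A \<inter> candidates ?R J \<alpha> m. ?l y \<in> ?T}"
      unfolding selected_def by blast
    ultimately show ?thesis by simp
  qed
  have "\<exists>K\<subseteq>J. infinite K \<and> bounded_labels ?R K"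
  proof (rule ccontr)
    assume unbounded: "\<not> ?thesis"
    have "\<exists>F\<subseteq>J. finite F \<and> good (E \<union> F) \<and> (\<exists>n>N. n \<in> ?T \<and> ?R F n)"
    proof (rule labelled_good_set[OF E J(4) hit[OF J(1,3)] _ hit_least])
      fix \<alpha> :: "nat set" assume "finite \<alpha>" "infinite {n. accepts ?R J \<alpha> n}"
      from split[OF accepted[OF this(1)] this(2), of i] show "infinite {n. accepts ?R J \<alpha> n \<and> n \<in> ?T}"
        by simp
    qed (use unbounded in blast)+
    then show False using none J(2) by blast
  qed
  then obtain K where "K \<subseteq> I" "infinite K" "bounded_labels ?R K" using J(2) by blast
  then show "\<exists>J\<in>\<M>. J \<subseteq> I \<and> infinite J \<and> bounded_labels ?R J"
    using reservoirs I(1) E(1) unfolding reservoirs_def by meson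
qed

section \<open>Mathias forcing with reservoirs from \<open>\<M>\<close>\<close>

definition mathias :: "nat set \<times> nat set \<Rightarrow> bool" where
  "mathias q \<longleftrightarrow> (case q of (E, I) \<Rightarrow> finite E \<and> good E \<and> I \<in> \<M> \<and> infinite I)"

definition le_mathias :: "nat set \<times> nat set \<Rightarrow> nat set \<times> nat set \<Rightarrow> bool" where
  "le_mathias q' q \<longleftrightarrow> (case (q', q) of ((E', I'), (E, I)) \<Rightarrow> E \<subseteq> E' \<and> E' \<subseteq> E \<union> I \<and> I' \<subseteq> I)"

definition forces_bounded :: "prog \<Rightarrow> (nat set \<times> nat set) set" where
  "forces_bounded p = {(E, I). bounded_labels (labels E p) I}"

definition forces_output :: "prog \<Rightarrow> bool \<Rightarrow> nat \<Rightarrow> (nat set \<times> nat set) set" where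
  "forces_output p i N = {(E, I). \<exists>n>N. (n \<in> U \<longleftrightarrow> i) \<and>
    (\<forall>H. E \<subseteq> H \<and> H \<subseteq> E \<union> I \<longrightarrow> computes H p [n] 1)}"

lemma tail_in_reservoirs: "I \<in> \<M> \<Longrightarrow> {y\<in>I. y > m} \<in> \<M>"
  using reservoirs unfolding reservoirs_def by blast

lemma infinite_tail:
  assumes "infinite (I :: nat set)"
  shows "infinite {y\<in>I. y > m}"
proof -
  have "I \<subseteq> {y\<in>I. y > m} \<union> {..m}" by auto
  then show ?thesis using assms by (metis finite_Un finite_atMost finite_subset)
qed

lemma dense_forces_output:
  assumes "mathias q"
  shows "\<exists>q'. mathias q' \<and> le_mathias q' q \<and> q' \<in> forces_bounded p \<union> forces_output p i N"
proof -
  obtain E I where q: "q = (E, I)" and E: "finite E" "good E" and I: "I \<in> \<M>" "infinite I"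
    using assms unfolding mathias_def by (cases q) auto
  from bounded_or_split[OF E I, of p N i] show ?thesis
  proof (elim disjE bexE exE conjE)
    fix J assume "J \<in> \<M>" "J \<subseteq> I" "infinite J" "bounded_labels (labels E p) J"
    then show ?thesis
      using E unfolding q mathias_def le_mathias_def forces_bounded_def by (intro exI[of _ "(E, J)"]) auto
  next
    fix F n assume F: "F \<subseteq> I" "finite F" "good (E \<union> F)" and n: "N < n" "n \<in> U \<longleftrightarrow> i" "labels E p F n"
    obtain u where u: "finite u" "\<And>B. B \<inter> u = (E \<union> F) \<inter> u \<Longrightarrow> computes B p [n] 1"
      using computes_near n(3) unfolding labels_def near_def by meson
    \<comment> \<open>Beyond \<open>m\<close> nothing of \<open>u\<close> is left, so every set
      between the new stem and its reservoir keeps the computation.\<close>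
    obtain m where m: "\<And>x. x \<in> u \<Longrightarrow> x \<le> m" using u(1) unfolding finite_nat_set_iff_bounded_le by blast
    let ?q = "(E \<union> F, {y\<in>I. y > m})"
    have "mathias ?q"
      unfolding mathias_def using E F I tail_in_reservoirs infinite_tail by auto
    moreover have "le_mathias ?q q" unfolding q le_mathias_def using F(1) by auto
    moreover have "?q \<in> forces_output p i N"
    proof -
      have "computes H p [n] 1" if H: "E \<union> F \<subseteq> H" "H \<subseteq> E \<union> F \<union> {y\<in>I. y > m}" for H
      proof (rule u(2))
        have "x \<notin> {y\<in>I. y > m}" if "x \<in> u" for x using m[OF that] by simp
        then show "H \<inter> u = (E \<union> F) \<inter> u" using H by blast
      qed
      then show ?thesis unfolding forces_output_def using n by blast
    qed
    ultimately show ?thesis by blast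
  qed
qed

lemma dense_large_element:
  assumes "mathias q"
  shows "\<exists>q'. mathias q' \<and> le_mathias q' q \<and> (\<exists>x>N. x \<in> fst q')"
proof -
  obtain E I where q: "q = (E, I)" and E: "finite E" "good E" and I: "I \<in> \<M>" "infinite I"
    using assms unfolding mathias_def by (cases q) auto
  obtain B where B: "B \<subseteq> A \<inter> I" "infinite B" "good (E \<union> B)"
    by (rule good_extension[OF hit[OF I] _ E]) (auto intro: that)
  obtain x where x: "x \<in> B" "x > N" using B(2) unfolding infinite_nat_iff_unbounded by blast
  then have "good (insert x E)" by (intro good_subset[OF B(3)]) auto
  then have "mathias (insert x E, I)" unfolding mathias_def using E I by simp
  moreover have "le_mathias (insert x E, I) q" unfolding q le_mathias_def using x B(1) by auto
  ultimately show ?thesis using x(2) by (intro exI[of _ "(insert x E, I)"]) auto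
qed

text \<open>\<open>H\<close> is the union of the stems of a generic sequence. An infinite
  \<open>Z\<close> computed from it has elements beyond each bound on both sides of
  \<open>U\<close>, because the bounded alternative would make \<open>Z\<close> finite.\<close>

lemma weak_homogeneous_set:
  obtains H where "infinite H" "good H"
    "\<And>Z. computable_from H Z \<Longrightarrow> infinite Z \<Longrightarrow> infinite (Z \<inter> U) \<and> infinite (Z \<inter> - U)"
proof -
  define large :: "nat \<Rightarrow> (nat set \<times> nat set) set" where "large = (\<lambda>N. {q. \<exists>x>N. x \<in> fst q})"
  define outp where "outp = (\<lambda>(p, i, N). forces_bounded p \<union> forces_output p i N)"
  let ?\<D> = "range large \<union> range outp"
  have count: "countable ?\<D>" by (intro countable_Un countable_image countableI_type)
  have init: "mathias ({}, UNIV)"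
    using reservoirs unfolding mathias_def reservoirs_def good_def by simp
  have refl: "le_mathias q q" for q unfolding le_mathias_def by (cases q) auto
  have trans: "le_mathias a b \<Longrightarrow> le_mathias b c \<Longrightarrow> le_mathias a c" for a b c
    unfolding le_mathias_def by (cases a; cases b; cases c) auto
  have dense: "\<exists>q'. mathias q' \<and> le_mathias q' q \<and> q' \<in> d" if d: "d \<in> ?\<D>" and q: "mathias q" for d q
  proof -
    consider N where "d = large N" | p i N where "d = forces_bounded p \<union> forces_output p i N"
      using d unfolding outp_def by auto
    then show ?thesis
      using dense_large_element[OF q] dense_forces_output[OF q] unfolding large_def by cases auto
  qed
  obtain f :: "nat \<Rightarrow> nat set \<times> nat set" where "f 0 = ({}, UNIV)" and cond: "\<And>n. mathias (f n)"
    and mono: "\<And>m n. m \<le> n \<Longrightarrow> le_mathias (f n) (f m)" and meet: "\<And>d. d \<in> ?\<D> \<Longrightarrow> \<exists>n. f n \<in> d"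
    by (rule rasiowa_sikorski[where C = mathias and r = le_mathias, OF count init refl trans dense])
      (assumption | rule that)+
  define H where "H = (\<Union>n. fst (f n))"
  have sub: "fst (f m) \<subseteq> fst (f n)" if "m \<le> n" for m n
    using mono[OF that] unfolding le_mathias_def by (auto split: prod.splits)
  have H: "E \<subseteq> H" "H \<subseteq> E \<union> I" if fn: "f n = (E, I)" for n E I
  proof -
    show "E \<subseteq> H" using UN_upper[of n UNIV "\<lambda>n. fst (f n)"] fn unfolding H_def by simp
    have "fst (f m) \<subseteq> E \<union> I" for m
    proof -
      have "fst (f m) \<subseteq> fst (f (max m n))" by (rule sub) simp
      moreover have "fst (f (max m n)) \<subseteq> E \<union> I"
        using mono[of n "max m n"] fn unfolding le_mathias_def by (auto split: prod.splits)
      ultimately show ?thesis by blast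
    qed
    then show "H \<subseteq> E \<union> I" unfolding H_def by blast
  qed
  have "\<exists>x\<in>H. x > N" for N
  proof -
    obtain n where "f n \<in> large N" using meet by blast
    then show ?thesis unfolding large_def H_def by auto
  qed
  then have "infinite H" unfolding infinite_iff_exceeds by blast
  moreover have "good H"
    unfolding good_def
  proof (intro conjI ballI impI)
    have gd: "good (fst (f n))" for n using cond[of n] unfolding mathias_def by (auto split: prod.splits)
    then show "H \<subseteq> A" unfolding H_def good_def by blast
    fix x y assume "x \<in> H" "y \<in> H" "x < y"
    then obtain k l where "x \<in> fst (f k)" "y \<in> fst (f l)" unfolding H_def by blast
    then have "x \<in> fst (f (max k l))" "y \<in> fst (f (max k l))"
      using sub[of k "max k l"] sub[of l "max k l"] by auto
    then show "col x y = j" using gd[of "max k l"] \<open>x < y\<close> unfolding good_def by blast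
  qed
  moreover have "infinite (Z \<inter> U) \<and> infinite (Z \<inter> - U)" if Z: "computable_from H Z" "infinite Z" for Z
  proof -
    obtain p where p: "\<And>x. computes H p [x] (of_bool (x \<in> Z))"
      using Z(1) unfolding computable_from_def by blast
    note mem = mem_iff_computes[of H p, OF p]
    have ex: "\<exists>n>N. n \<in> Z \<and> (n \<in> U \<longleftrightarrow> i)" for i N
    proof -
      have "outp (p, i, N) \<in> ?\<D>" by blast
      then obtain s where s: "f s \<in> outp (p, i, N)" using meet by blast
      obtain E I where fs: "f s = (E, I)" by (cases "f s")
      have "f s \<notin> forces_bounded p"
      proof
        assume "f s \<in> forces_bounded p"
        then obtain b where b: "\<And>F n. F \<subseteq> I \<Longrightarrow> finite F \<Longrightarrow> labels E p F n \<Longrightarrow> n \<le> b"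
          unfolding forces_bounded_def bounded_labels_def fs by auto
        have "n \<le> b" if n: "n \<in> Z" for n
        proof -
          obtain u where u: "finite u" "\<And>B. B \<inter> u = H \<inter> u \<Longrightarrow> computes B p [n] 1"
            using computes_near mem n unfolding near_def by meson
          have "(E \<union> (H \<inter> u - E)) \<inter> u = H \<inter> u" using H(1)[OF fs] by blast
          then have "labels E p (H \<inter> u - E) n" unfolding labels_def by (rule u(2))
          moreover have "H \<inter> u - E \<subseteq> I" using H(2)[OF fs] by blast
          ultimately show ?thesis using b u(1) by blast
        qed
        then show False using Z(2) unfolding finite_nat_set_iff_bounded_le by blast
      qed
      then have "f s \<in> forces_output p i N" using s unfolding outp_def by simp
      then obtain n where "n > N" "n \<in> U \<longleftrightarrow> i" "computes H p [n] 1"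
        using H[OF fs] unfolding forces_output_def fs by blast
      then show ?thesis using mem by blast
    qed
    have "\<exists>n\<in>Z \<inter> U. n > N" "\<exists>n\<in>Z \<inter> - U. n > N" for N
      using ex[of N True] ex[of N False] by auto
    then show ?thesis unfolding infinite_iff_exceeds by blast
  qed
  ultimately show thesis by (rule that)
qed

end

subsection \<open>Homogeneous sets computed from the family\<close>

lemma mem_family_set: "z \<in> family_set X \<longleftrightarrow> snd (prod_decode z) \<in> X (fst (prod_decode z))"
proof -
  have "\<exists>k n. z = prod_encode (k, n)" by (metis prod_decode_inverse prod.collapse)
  then show ?thesis unfolding family_set_def by (auto simp: prod_encode_eq)
qed

lemma mem_join: "z \<in> join A B \<longleftrightarrow> (if even z then z div 2 \<in> A else z div 2 \<in> B)"
  unfolding join_def by (auto elim!: evenE oddE; presburger)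

lemma near_family_set:
  "near S (\<lambda>S'. z \<in> family_set (family_of S') \<longleftrightarrow> z \<in> family_set (family_of S))"
  unfolding mem_family_set family_of_def using near_mem[of S "prod_decode z"] by simp

lemma near_join:
  assumes "\<And>z. near S (\<lambda>S'. z \<in> f S' \<longleftrightarrow> z \<in> f S)" "\<And>z. near S (\<lambda>S'. z \<in> g S' \<longleftrightarrow> z \<in> g S)"
  shows "near S (\<lambda>S'. z \<in> join (f S') (g S') \<longleftrightarrow> z \<in> join (f S) (g S))"
  unfolding mem_join using assms by simp

text \<open>For a family on which \<open>e\<close> diverges, \<open>THE\<close> gives an unspecified
  color; only continuity at a family where \<open>e\<close> is total will be used.\<close>

definition colour_of :: "prog \<Rightarrow> (nat \<times> nat) set \<Rightarrow> nat \<Rightarrow> nat \<Rightarrow> nat" where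
  "colour_of e S a b = (THE v. computes (family_set (family_of S)) e [a, b] v)"

text \<open>The cutoff \<open>b\<close> will discard the finitely many points of the opposite limit
  color.\<close>

definition greedy_of :: "prog \<Rightarrow> nat \<Rightarrow> ((nat \<times> nat) set \<Rightarrow> nat set) \<Rightarrow> nat \<Rightarrow> (nat \<times> nat) set \<Rightarrow> nat set" where
  "greedy_of e j G b S = Collect (greedy (colour_of e S) j {y\<in>G S. b \<le> y})"

definition output_of :: "prog \<Rightarrow> prog \<Rightarrow> nat \<Rightarrow> ((nat \<times> nat) set \<Rightarrow> nat set) \<Rightarrow> nat \<Rightarrow> (nat \<times> nat) set \<Rightarrow> nat set" where
  "output_of p e j G b S =
    {n. computes (join (family_set (family_of S)) (greedy_of e j G b S)) p [n] 1}"

lemma colour_of_eq: "computes (family_set (family_of S)) e [a, b] v \<Longrightarrow> colour_of e S a b = v"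
  unfolding colour_of_def by (rule the_equality) (auto intro: computes_deterministic)

text \<open>Deciding \<open>x\<close> takes finitely many colors and finitely many membership bits
  of \<open>G\<close>. Totality of \<open>e\<close> at \<open>S\<close> gives each color a halting
  computation, which persists near \<open>S\<close>.\<close>

lemma near_greedy_of:
  assumes total: "\<And>a b. a < b \<Longrightarrow> \<exists>v. computes (family_set (family_of S)) e [a, b] v"
    and G: "\<And>y. near S (\<lambda>S'. y \<in> G S' \<longleftrightarrow> y \<in> G S)"
  shows "near S (\<lambda>S'. x \<in> greedy_of e j G b S' \<longleftrightarrow> x \<in> greedy_of e j G b S)"
proof -
  have colour: "near S (\<lambda>S'. colour_of e S' a d = colour_of e S a d)" if ad: "a < d" for a d
  proof -
    obtain v where v: "computes (family_set (family_of S)) e [a, d] v" using total[OF ad] by blast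
    have "near S (\<lambda>S'. computes (family_set (family_of S')) e [a, d] v)"
      by (rule near_compose[OF computes_near[OF v] near_family_set])
    then show ?thesis by (rule near_mono) (use v colour_of_eq in metis)
  qed
  have "near S (\<lambda>S'. \<forall>q\<in>{(a, d). a < d \<and> d \<le> x}. colour_of e S' (fst q) (snd q) = colour_of e S (fst q) (snd q))"
  proof (rule near_ball)
    have "{(a, d). a < d \<and> d \<le> x} \<subseteq> {..x} \<times> {..x}" by auto
    then show "finite {(a, d). a < d \<and> d \<le> x}" by (rule finite_subset) simp
  qed (use colour in auto)
  moreover have "near S (\<lambda>S'. \<forall>y\<in>{..x}. y \<in> G S' \<longleftrightarrow> y \<in> G S)"
    by (rule near_ball) (use G in auto)
  ultimately have "near S (\<lambda>S'. (\<forall>q\<in>{(a, d). a < d \<and> d \<le> x}.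
      colour_of e S' (fst q) (snd q) = colour_of e S (fst q) (snd q)) \<and> (\<forall>y\<in>{..x}. y \<in> G S' \<longleftrightarrow> y \<in> G S))"
    by (rule near_conj)
  then show ?thesis
  proof (rule near_mono, elim conjE)
    fix S'
    assume c: "\<forall>q\<in>{(a, d). a < d \<and> d \<le> x}. colour_of e S' (fst q) (snd q) = colour_of e S (fst q) (snd q)"
      and g: "\<forall>y\<in>{..x}. y \<in> G S' \<longleftrightarrow> y \<in> G S"
    show "x \<in> greedy_of e j G b S' \<longleftrightarrow> x \<in> greedy_of e j G b S"
      unfolding greedy_of_def mem_Collect_eq by (rule greedy_cong) (use c g in auto)
  qed
qed

lemma near_output_of:
  assumes "\<And>a b. a < b \<Longrightarrow> \<exists>v. computes (family_set (family_of S)) e [a, b] v"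
    and "\<And>y. near S (\<lambda>S'. y \<in> G S' \<longleftrightarrow> y \<in> G S)" and "n \<in> output_of p e j G b S"
  shows "near S (\<lambda>S'. n \<in> output_of p e j G b S')"
proof -
  have "near (join (family_set (family_of S)) (greedy_of e j G b S)) (\<lambda>B. computes B p [n] 1)"
    using assms(3) unfolding output_of_def by (intro computes_near) simp
  from near_compose[where f = "\<lambda>S. join (family_set (family_of S)) (greedy_of e j G b S)",
      OF this near_join[OF near_family_set near_greedy_of[OF assms(1,2)]]]
  show ?thesis unfolding output_of_def by simp
qed

section \<open>Choice of the family and of the collection \<open>Y\<close>\<close>

theorem theorem5p2:
  "\<exists>(X :: nat \<Rightarrow> nat set) (Y :: nat set set).
    (\<forall>P\<in>Y. infinite P) \<and>
    (\<forall>P\<in>Y. \<not> (\<exists>Z. computable_from (join (family_set X) P) Z \<and> infinite Z \<and> cohesive X Z)) \<and>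
    (\<forall>c :: nat set \<Rightarrow> nat.
      stable_coloring c \<and> coloring_computable_from (family_set X) c \<longrightarrow>
        (\<exists>P\<in>Y. \<exists>H. computable_from (join (family_set X) P) H \<and> infinite H \<and>
          (\<exists>j<2. homogeneous c j H)) \<or>
        (\<forall>j<2. \<exists>H. infinite H \<and> homogeneous c j H \<and>
          \<not> (\<exists>Z. computable_from H Z \<and> infinite Z \<and> cohesive X Z)))"
proof -
  obtain \<M> where \<M>: "countable \<M>" "reservoirs \<M>" by (rule reservoirs_exist)
  let ?Fin = "Collect finite :: nat set set"
  \<comment> \<open>The sets to be hit are listed as functions of the yet unknown generic
    \<open>S\<close>, because the selected parts depend on its column \<open>0\<close>.\<close>
  define const :: "nat set \<Rightarrow> (nat \<times> nat) set \<Rightarrow> nat set" where "const = (\<lambda>I S. I)"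
  define sel where "sel = (\<lambda>(E, p, I, \<alpha>, m, i) S. selected E p I \<alpha> m i (family_of S 0))"
  define \<G> where "\<G> = const ` \<M> \<union> sel ` (?Fin \<times> UNIV \<times> \<M> \<times> ?Fin \<times> UNIV \<times> UNIV)"
  define \<W> where "\<W> = (\<lambda>(p, e, j, G, b). output_of p e j G b) ` (UNIV \<times> UNIV \<times> UNIV \<times> \<G> \<times> UNIV)"
  have "countable \<G>"
    unfolding \<G>_def using \<M>(1)
    by (intro countable_Un countable_image countable_SIGMA countable_Collect_finite countableI_type)
  then have "countable \<W>"
    unfolding \<W>_def by (intro countable_image countable_SIGMA countableI_type)
  have near_\<G>: "near S (\<lambda>S'. y \<in> G S' \<longleftrightarrow> y \<in> G S)" if G: "G \<in> \<G>" for G S y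
  proof -
    consider I where "G = const I" | E p I \<alpha> m i where "G = sel (E, p, I, \<alpha>, m, i)"
      using G unfolding \<G>_def by auto
    then show ?thesis
    proof cases
      case 1
      then show ?thesis unfolding const_def by (intro near_all) simp
    next
      case 2
      show ?thesis
        using near_mem[of S "(0, least_label (labels E p) I \<alpha> m y)"]
        unfolding 2 sel_def selected_def family_of_def by (rule near_mono) simp
    qed
  qed
  obtain S where split: "\<And>I i. I \<in> \<M> \<Longrightarrow> infinite I \<Longrightarrow> infinite {n\<in>I. n \<in> family_of S 0 \<longleftrightarrow> i}"
    and generic: "\<And>W. W \<in> \<W> \<Longrightarrow> \<forall>n\<in>W S. near S (\<lambda>S'. n \<in> W S') \<Longrightarrow> infinite (W S)
      \<Longrightarrow> \<not> cohesive (family_of S) (W S)"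
    by (rule generic_family_exists[OF \<M>(1) \<open>countable \<W>\<close>]) (assumption | rule that)+
  define X where "X = family_of S"
  \<comment> \<open>The largest choice that clause (i) allows; the work lies in showing that greedy
    sets belong to it.\<close>
  define Y where "Y = {P. infinite P \<and>
    \<not> (\<exists>Z. computable_from (join (family_set X) P) Z \<and> infinite Z \<and> cohesive X Z)}"
  have "\<forall>j<2. \<exists>H. infinite H \<and> homogeneous c j H \<and>
      \<not> (\<exists>Z. computable_from H Z \<and> infinite Z \<and> cohesive X Z)"
    if stable: "stable_coloring c" and comp: "coloring_computable_from (family_set X) c"
      and none: "\<not> (\<exists>P\<in>Y. \<exists>H. computable_from (join (family_set X) P) H \<and> infinite H \<and>
        (\<exists>j<2. homogeneous c j H))" for c
  proof -
    obtain e where e: "\<And>x y. x < y \<Longrightarrow> computes (family_set (family_of S)) e [x, y] (c {x, y})"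
      using comp unfolding coloring_computable_from_def X_def by blast
    have col: "colour_of e S x y = c {x, y}" if "x < y" for x y
      using colour_of_eq[OF e[OF that]] .
    define A where "A = (\<lambda>j. {x. \<forall>\<^sub>F y in sequentially. c {x, y} = j})"
    have cover: "x \<in> A 0 \<union> A 1" for x
    proof -
      obtain l where "(\<lambda>y. c {x, y}) \<longlonglongrightarrow> l"
        using stable unfolding stable_coloring_def convergent_def by blast
      then have ev: "\<forall>\<^sub>F y in sequentially. c {x, y} = l" by (simp add: tendsto_discrete)
      have "\<forall>\<^sub>F y in sequentially. c {x, y} < 2"
        using eventually_gt_at_top[of x]
      proof eventually_elim
        case (elim y)
        then have "{x, y} \<in> nsets UNIV 2" unfolding nsets_def by simp
        then show ?case using stable unfolding stable_coloring_def by blast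
      qed
      with ev have "\<forall>\<^sub>F y in sequentially. l < 2" by eventually_elim simp
      then have "l = 0 \<or> l = 1" by auto
      with ev show ?thesis unfolding A_def by auto
    qed
    have colour: "limit_colour (colour_of e S) j (A j)" for j
    proof
      fix x assume "x \<in> A j"
      then have "\<forall>\<^sub>F y in sequentially. c {x, y} = j" unfolding A_def by simp
      then show "\<forall>\<^sub>F y in sequentially. colour_of e S x y = j"
        using eventually_gt_at_top[of x] by eventually_elim (simp add: col)
    qed
    have homogeneous: "homogeneous c j H" if "limit_colour.good (colour_of e S) j (A j) H" for j H
      using that col unfolding limit_colour.good_def[OF colour] homogeneous_def by simp
    \<comment> \<open>If \<open>A j\<close> met \<open>G S\<close> only finitely often, all later
      points of \<open>G S\<close> would have the other limit color, and their greedy set would be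
      an infinite homogeneous set in \<open>Y\<close>, contrary to \<open>none\<close>.\<close>
    have hit: "infinite (A j \<inter> G S)" if G: "G \<in> \<G>" "infinite (G S)" and j: "j < 2" for G j
    proof
      assume "finite (A j \<inter> G S)"
      then obtain b where b: "\<And>x. x \<in> A j \<inter> G S \<Longrightarrow> x < b"
        unfolding finite_nat_set_iff_bounded by blast
      define k where "k = 1 - j"
      have k: "k < 2" unfolding k_def by simp
      let ?C = "{y\<in>G S. b \<le> y}"
      let ?H = "greedy_of e k G b S"
      have sub: "?C \<subseteq> A k"
      proof clarify
        fix y assume y: "y \<in> G S" "b \<le> y"
        then have "y \<notin> A j" using b[of y] by auto
        then show "y \<in> A k" using cover[of y] j unfolding k_def by (cases j) auto
      qed
      have "G S \<subseteq> ?C \<union> {..<b}" by auto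
      then have "infinite ?C" using G(2) by (metis finite_Un finite_lessThan finite_subset)
      then have H: "infinite ?H" "homogeneous c k ?H"
        using limit_colour.infinite_greedy[OF colour _ sub] limit_colour.good_greedy[OF colour sub]
          homogeneous unfolding greedy_of_def by blast+
      have "\<not> cohesive X Z" if Z: "computable_from (join (family_set X) ?H) Z" "infinite Z" for Z
      proof -
        obtain p where p: "\<And>x. computes (join (family_set X) ?H) p [x] (of_bool (x \<in> Z))"
          using Z(1) unfolding computable_from_def by blast
        \<comment> \<open>An infinite \<open>Z\<close> computed from the family and the greedy set
          is a value of a functional in \<open>\<W>\<close>, so genericity applies to it.\<close>
        have "Z = output_of p e k G b S"
          unfolding output_of_def X_def[symmetric]
          using mem_iff_computes[OF p] by blast
        moreover have "output_of p e k G b \<in> \<W>"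
          unfolding \<W>_def using G(1) by (intro image_eqI[of _ _ "(p, e, k, G, b)"]) auto
        ultimately show ?thesis
          using generic[of "output_of p e k G b"] near_output_of[OF _ near_\<G>[OF G(1)]] e Z(2)
          unfolding X_def by blast
      qed
      then have "?H \<in> Y" unfolding Y_def using H(1) by blast
      then show False using none computable_from_join_right H k by blast
    qed
    show ?thesis
    proof (intro allI impI)
      fix j :: nat assume j: "j < 2"
      interpret hitting_colour "colour_of e S" j "A j" \<M> "X 0"
      proof (intro hitting_colour.intro hitting_colour_axioms.intro)
        show "limit_colour (colour_of e S) j (A j)" by (rule colour)
        show "reservoirs \<M>" by (rule \<M>(2))
        fix I assume I: "I \<in> \<M>"
        show "infinite {n\<in>I. n \<in> X 0 \<longleftrightarrow> i}" if "infinite I" for i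
          unfolding X_def using split[OF I that] .
        have "const I \<in> \<G>" unfolding \<G>_def using I by blast
        then show "infinite (A j \<inter> I)" if "infinite I"
          using hit[of "const I", OF _ _ j] that unfolding const_def by blast
        fix E \<alpha> p m i assume "finite (E :: nat set)" "finite (\<alpha> :: nat set)"
          and inf: "infinite (selected E p I \<alpha> m i (X 0))"
        then have "sel (E, p, I, \<alpha>, m, i) \<in> \<G>" unfolding \<G>_def using I by (intro UnI2 imageI) auto
        from hit[OF this _ j] inf show "infinite (A j \<inter> selected E p I \<alpha> m i (X 0))"
          unfolding sel_def X_def by simp
      qed
      obtain H where H: "infinite H" "good H"
        and split: "\<And>Z. computable_from H Z \<Longrightarrow> infinite Z \<Longrightarrow> infinite (Z \<inter> X 0) \<and> infinite (Z \<inter> - X 0)"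
        by (rule weak_homogeneous_set) (assumption | rule that)+
      have "\<not> cohesive X Z" if "computable_from H Z" "infinite Z" for Z
        using split[OF that] unfolding cohesive_def by blast
      then show "\<exists>H. infinite H \<and> homogeneous c j H \<and>
          \<not> (\<exists>Z. computable_from H Z \<and> infinite Z \<and> cohesive X Z)"
        using H(1) homogeneous[OF H(2)] by blast
    qed
  qed
  then show ?thesis
    by (intro exI[of _ X] exI[of _ Y]) (auto simp: Y_def)
qed

end
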